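(* Let $n_1, n_2, \ldots, n_t$ be a sequence of sufficiently large integers, of which $t_e$ are even and $t_o$ are odd. Let $c=82\times 35^{2^{t_o}-2}\times 81^{t_e}$ and $n=\max(n_1,\dots,n_t)$, and suppose that for all $i$ we have $n_i\geq 2\lceil \log (nc) \rceil+2$. Then $$\hat{R}(C_{n_1},\ldots,C_{n_t})\leq (\ln c+1)\,c^2\, n.$$
   Context: $C_k$ denotes the cycle on $k$ vertices. For graphs $G_1,\ldots,G_k$, the size-Ramsey number $\hat{R}(G_1,\ldots,G_k)$ is the smallest integer $m$ for which there exists a graph $H$ with $m$ edges such that for every coloring of the edges of $H$ with colors $1,\ldots,k$ there is, for some $i$, a copy of $G_i$ in $H$ all of whose edges have color $i$. $\log$ denotes the logarithm to base $2$ and $\ln$ the natural logarithm. *)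

theory Defs
  imports Complex_Main
begin

definition is_graph :: "nat set set \<Rightarrow> bool" where
  "is_graph E \<longleftrightarrow> finite E \<and> (\<forall>e\<in>E. card e = 2)"

definition has_cycle :: "nat \<Rightarrow> nat set set \<Rightarrow> bool" where
  "has_cycle k F \<longleftrightarrow> 3 \<le> k \<and>
     (\<exists>f :: nat \<Rightarrow> nat. inj_on f {0..<k} \<and>
        (\<forall>i<k. {f i, f (Suc i mod k)} \<in> F))"

definition arrows_cycles :: "nat set set \<Rightarrow> nat list \<Rightarrow> bool" where
  "arrows_cycles E ns \<longleftrightarrow>
     (\<forall>col :: nat set \<Rightarrow> nat. (\<forall>e\<in>E. col e < length ns) \<longrightarrow>
        (\<exists>i<length ns. has_cycle (ns ! i) {e\<in>E. col e = i}))"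

definition size_ramsey_cycles :: "nat list \<Rightarrow> nat" where
  "size_ramsey_cycles ns =
     (LEAST m. \<exists>E. is_graph E \<and> card E = m \<and> arrows_cycles E ns)"

end

theory Submission
  imports Defs
begin

text \<open>
  A greedy hitting argument gives a graph on a constant multiple of \<open>n\<close> vertices, with the stated
  number of edges, in which any two disjoint \<open>n\<close>-sets are joined by an edge. Given a colouring, colours
  are eliminated one at a time: a colour without its cycle leaves a few large vertex sets between
  which it has no edge at all. Once every colour is eliminated, two disjoint \<open>n\<close>-sets remain with no
  edge between them, a contradiction.

  The engine is that a pair of large clusters without such a hole contains paths of every
  admissible length: two breadth-first trees in disjoint expanding parts supply many end vertices at
  an exact depth, and a depth-first path of prescribed length connects the two trees. An even colour is thus
  eliminated from one pair of clusters. For an odd colour, an odd cycle of clusters with no holes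
  would close up to the forbidden odd cycle, so the pairs without holes form a bipartite graph,
  and more than half of an odd number of clusters can be made pairwise free of that colour.
\<close>

section \<open>Expansion and paths of prescribed length\<close>

text \<open>The tight hypothesis is \<open>n_i >= 2 * ceil (log (n * c)) + 2\<close>. With balls
  that merely double, the two trees at the ends of a path could use about
  \<open>2 * log (n * c)\<close> vertices, leaving no room for the clusters passed on the way. The
  balls are therefore made to triple: since \<open>2 ^ 3 < 3 ^ 2\<close>, a depth of about two
  thirds of \<open>log (n * c)\<close> suffices, and for large \<open>n_i\<close> the gain covers
  all additive terms. The price is 10 thresholds per tree and side. Two trees and 5 thresholds for
  the middle path give the factor 25 of a split; two such clusters and one of size 2 that is only
  passed through give 52. The numbers 82, 35 and 81 do not arise here: they are only shown to
  dominate the losses. Two clusters yield even lengths only, so an odd colour needs an odd number of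
  clusters. As it turns \<open>2 * q + 1\<close> clusters into \<open>q + 1\<close>, a supply
  exponential in the number of odd colours must be prepared, and one cluster may be cut
  \<open>2 * q - 1\<close> times. These exponents add up to order \<open>2 ^ t_o\<close>.\<close>

definition nbh :: "('a \<Rightarrow> 'a \<Rightarrow> bool) \<Rightarrow> 'a set \<Rightarrow> 'a set \<Rightarrow> 'a set" where
  "nbh R W S = {y \<in> W - S. \<exists>x\<in>S. R x y}"

text \<open>Discard a largest set of weight below \<open>Q\<close> that fails to expand: the union with another failing set
  would again fail to expand, hence have weight below \<open>Q\<close> by \<open>big\<close>, against maximality.\<close>

lemma expanding_subset:
  fixes w :: "'a \<Rightarrow> nat"
  assumes fin: "finite W" and pos: "0 < Q"
    and big: "\<And>T. T \<subseteq> W \<Longrightarrow> Q \<le> sum w T \<Longrightarrow> sum w T < 2 * Q \<Longrightarrow> 2 * sum w T < sum w (nbh R W T)"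
  obtains U where "U \<subseteq> W" "sum w U < Q"
    "\<And>S. S \<subseteq> W - U \<Longrightarrow> S \<noteq> {} \<Longrightarrow> sum w S < Q \<Longrightarrow> 2 * sum w S < sum w (nbh R (W - U) S)"
proof -
  define \<U> where "\<U> = {U. U \<subseteq> W \<and> sum w U < Q \<and> sum w (nbh R W U) \<le> 2 * sum w U}"
  have U0: "{} \<in> \<U>" using pos by (auto simp: \<U>_def nbh_def)
  have "\<forall>T. T \<in> \<U> \<longrightarrow> card T < Suc (card W)"
    using fin by (auto simp: \<U>_def less_Suc_eq_le intro: card_mono)
  with U0 obtain U where U: "U \<in> \<U>" and max: "\<And>T. T \<in> \<U> \<Longrightarrow> card T \<le> card U"
    using ex_has_greatest_nat[of "\<lambda>U. U \<in> \<U>" "{}" card "Suc (card W)"] by blast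
  have UW: "U \<subseteq> W" and UQ: "sum w U < Q" and UN: "sum w (nbh R W U) \<le> 2 * sum w U"
    using U by (auto simp: \<U>_def)
  have finU: "finite U" using UW fin finite_subset by blast
  show ?thesis
  proof (rule that[OF UW UQ])
    fix S assume S: "S \<subseteq> W - U" "S \<noteq> {}" "sum w S < Q"
    show "2 * sum w S < sum w (nbh R (W - U) S)"
    proof (rule ccontr)
      assume "\<not> ?thesis"
      then have le: "sum w (nbh R (W - U) S) \<le> 2 * sum w S" by simp
      have finS: "finite S" using S fin finite_subset by blast
      have fN: "finite (nbh R W U)" "finite (nbh R (W - U) S)" using fin by (auto simp: nbh_def)
      have "sum w (nbh R W (U \<union> S)) \<le> sum w (nbh R W U \<union> nbh R (W - U) S)"
        by (rule sum_mono2) (use fN in \<open>auto simp: nbh_def\<close>)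
      also have "\<dots> \<le> sum w (nbh R W U) + sum w (nbh R (W - U) S)"
        using sum.union_inter[OF fN, of w] by simp
      finally have N: "sum w (nbh R W (U \<union> S)) \<le> 2 * (sum w U + sum w S)" using le UN by simp
      have un: "sum w (U \<union> S) = sum w U + sum w S"
        by (rule sum.union_disjoint) (use S finU finS in auto)
      have sub: "U \<union> S \<subseteq> W" using S UW by auto
      have "sum w (U \<union> S) < Q"
        using big[OF sub] N un UQ S(3) by (metis add_less_mono mult_2 not_le)
      then have "U \<union> S \<in> \<U>" using N sub un by (auto simp: \<U>_def)
      then have "card (U \<union> S) \<le> card U" by (rule max)
      moreover have "card (U \<union> S) = card U + card S"
        by (rule card_Un_disjoint) (use S finU finS in auto)
      ultimately show False using S(2) finS by auto
    qed
  qed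
qed

text \<open>While the ball weighs less than \<open>Q\<close>, its next layer weighs more than twice
  as much, so the ball more than triples. Hence the depth is logarithmic to base 3, and the last
  layer alone carries two thirds of the final ball. The bound on \<open>3 ^ (d - 1) * w r\<close>
  records that the ball one step earlier was still below \<open>Q\<close>.\<close>

lemma bfs_layer:
  fixes w :: "'a \<Rightarrow> nat"
  assumes fin: "finite W" and r: "r \<in> W" "0 < w r"
    and expand: "\<And>S. S \<subseteq> W \<Longrightarrow> S \<noteq> {} \<Longrightarrow> sum w S < Q \<Longrightarrow> 2 * sum w S < sum w (nbh R W S)"
  obtains d X where "X \<subseteq> W" "2 * Q \<le> 3 * sum w X" "d = 0 \<or> 3 ^ (d - 1) * w r < Q"
    "\<And>x. x \<in> X \<Longrightarrow> \<exists>xs. length xs = Suc d \<and> hd xs = r \<and> last xs = x \<and> distinct xs \<and>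
                      successively R xs \<and> set xs \<subseteq> W"
proof -
  \<comment> \<open>Only the last layer \<open>X\<close> of the ball \<open>B\<close> has neighbours outside \<open>B\<close>, so path lengths are exact.\<close>
  define state where "state i B X \<longleftrightarrow> X \<subseteq> B \<and> B \<subseteq> W \<and> r \<in> B \<and> 3 ^ i * w r \<le> sum w B
      \<and> 2 * sum w B \<le> 3 * sum w X \<and> (i = 0 \<or> 3 ^ (i - 1) * w r < Q)
      \<and> (\<forall>x\<in>B - X. \<forall>y\<in>W. R x y \<longrightarrow> y \<in> B)
      \<and> (\<forall>x\<in>X. \<exists>xs. length xs = Suc i \<and> hd xs = r \<and> last xs = x \<and> distinct xs \<and>
                      successively R xs \<and> set xs \<subseteq> B)" for i B X
  have step: "\<exists>B' X'. state (Suc i) B' X'" if st: "state i B X" and lt: "sum w B < Q" for i B X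
  proof -
    let ?X = "nbh R W B" and ?B = "B \<union> nbh R W B"
    have BW: "B \<subseteq> W" "r \<in> B" and low: "3 ^ i * w r \<le> sum w B" using st by (auto simp: state_def)
    have finB: "finite B" "finite ?X" using BW fin finite_subset by (auto simp: nbh_def)
    have ex: "2 * sum w B < sum w ?X" using expand[of B] BW lt by auto
    have un: "sum w ?B = sum w B + sum w ?X"
      by (rule sum.union_disjoint) (use finB in \<open>auto simp: nbh_def\<close>)
    have paths: "\<exists>xs. length xs = Suc (Suc i) \<and> hd xs = r \<and> last xs = x \<and> distinct xs \<and>
                      successively R xs \<and> set xs \<subseteq> ?B" if x: "x \<in> ?X" for x
    proof -
      obtain y where y: "y \<in> B" "R y x" "x \<in> W" "x \<notin> B" using x by (auto simp: nbh_def)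
      then have "y \<in> X" using st by (auto simp: state_def)
      then obtain xs where xs: "length xs = Suc i" "hd xs = r" "last xs = y" "distinct xs"
          "successively R xs" "set xs \<subseteq> B"
        using st unfolding state_def by blast
      have ne: "xs \<noteq> []" using xs(1) by auto
      have "length (xs @ [x]) = Suc (Suc i) \<and> hd (xs @ [x]) = r \<and> last (xs @ [x]) = x
          \<and> distinct (xs @ [x]) \<and> successively R (xs @ [x]) \<and> set (xs @ [x]) \<subseteq> ?B"
        using xs y ne x by (auto simp: successively_append_iff)
      then show ?thesis by blast
    qed
    have "state (Suc i) ?B ?X"
      unfolding state_def
    proof (intro conjI)
      show "3 ^ Suc i * w r \<le> sum w ?B" using low ex un by simp
      show "2 * sum w ?B \<le> 3 * sum w ?X" using ex un by simp
      show "Suc i = 0 \<or> 3 ^ (Suc i - 1) * w r < Q" using low lt by simp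
      show "\<forall>x\<in>?B - ?X. \<forall>y\<in>W. R x y \<longrightarrow> y \<in> ?B" by (auto simp: nbh_def)
      show "\<forall>x\<in>?X. \<exists>xs. length xs = Suc (Suc i) \<and> hd xs = r \<and> last xs = x \<and> distinct xs \<and>
                      successively R xs \<and> set xs \<subseteq> ?B"
        using paths by blast
    qed (use BW in \<open>auto simp: nbh_def\<close>)
    then show ?thesis by blast
  qed
  have "(\<exists>B X. state i B X) \<or> (\<exists>d B X. state d B X \<and> Q \<le> sum w B)" for i
  proof (induction i)
    case 0
    have "state 0 {r} {r}" using r by (auto simp: state_def intro!: exI[of _ "[r]"])
    then show ?case by blast
  next
    case (Suc i)
    then show ?case using step by (meson not_le)
  qed
  \<comment> \<open>\<open>Q\<close> rounds suffice: a ball that has grown that often weighs at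
    least \<open>3 ^ Q * w r\<close>, already more than \<open>Q\<close>.\<close>
  from this[of Q] obtain d B X where st: "state d B X" and ge: "Q \<le> sum w B"
  proof
    assume "\<exists>B X. state Q B X"
    then obtain B X where st: "state Q B X" by blast
    have "Q < 3 ^ Q" by (rule less_exp[THEN less_le_trans]) (simp add: power_mono)
    also have "\<dots> \<le> 3 ^ Q * w r" using r by simp
    also have "\<dots> \<le> sum w B" using st by (simp add: state_def)
    finally show thesis using that st by simp
  qed (use that in blast)
  show ?thesis
  proof (rule that[of X d])
    show "2 * Q \<le> 3 * sum w X" "X \<subseteq> W" "d = 0 \<or> 3 ^ (d - 1) * w r < Q"
      using st ge by (auto simp: state_def)
    fix x assume "x \<in> X"
    then show "\<exists>xs. length xs = Suc d \<and> hd xs = r \<and> last xs = x \<and> distinct xs \<and>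
                      successively R xs \<and> set xs \<subseteq> W"
      using st unfolding state_def by (meson subset_trans)
  qed
qed

text \<open>Depth-first search: \<open>S\<close> is the set of finished vertices, the list is the current stack, and there is
  no edge from \<open>S\<close> to the unexplored vertices, so neither side of \<open>S\<close> can reach its threshold
  while the stack is short.\<close>

lemma alternating_path:
  fixes P :: "bool \<Rightarrow> 'a set" and k :: "bool \<Rightarrow> nat"
  assumes fin: "\<And>b. finite (P b)" and disj: "P True \<inter> P False = {}"
    and sym: "\<And>x y. R x y \<Longrightarrow> R y x"
    and joined: "\<And>X Y. X \<subseteq> P True \<Longrightarrow> Y \<subseteq> P False \<Longrightarrow> k True \<le> card X \<Longrightarrow> k False \<le> card Y \<Longrightarrow>
                   \<exists>x\<in>X. \<exists>y\<in>Y. R x y"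
    and size: "\<And>b. 2 * k b + L \<le> card (P b)" and L: "0 < L"
  obtains xs where "length xs = L" "distinct xs" "hd xs \<in> P b" "set xs \<subseteq> P True \<union> P False"
    "successively (\<lambda>x y. R x y \<and> (\<exists>c. x \<in> P c \<and> y \<in> P (\<not> c))) xs"
proof -
  define R' where "R' = (\<lambda>x y. R x y \<and> (\<exists>c. x \<in> P c \<and> y \<in> P (\<not> c)))"
  define V where "V = P True \<union> P False"
  have finV: "finite V" using fin by (simp add: V_def)
  have PV: "P c \<subseteq> V" for c by (cases c) (auto simp: V_def)
  have joined': "\<exists>x\<in>X. \<exists>y\<in>Y. R' y x" if "X \<subseteq> P c" "Y \<subseteq> P (\<not> c)" "k c \<le> card X" "k (\<not> c) \<le> card Y"
    for c X Y
  proof -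
    obtain x y where "x \<in> X" "y \<in> Y" "R y x"
    proof (cases c)
      case True
      then show ?thesis using joined[of X Y] \<open>X \<subseteq> P c\<close> \<open>Y \<subseteq> P (\<not> c)\<close> \<open>k c \<le> card X\<close> \<open>k (\<not> c) \<le> card Y\<close> that
        by (metis sym)
    next
      case False
      then show ?thesis using joined[of Y X] \<open>X \<subseteq> P c\<close> \<open>Y \<subseteq> P (\<not> c)\<close> \<open>k c \<le> card X\<close> \<open>k (\<not> c) \<le> card Y\<close> that
        by auto
    qed
    then show ?thesis using that unfolding R'_def
      by (intro bexI[of _ x] bexI[of _ y] conjI exI[of _ "\<not> c"]) auto
  qed
  \<comment> \<open>One vertex more than required: if the path starts on the wrong side, its first
    vertex is dropped below.\<close>
  have "\<exists>xs. Suc L \<le> length xs \<and> distinct xs \<and> successively R' xs \<and> set xs \<subseteq> V"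
  proof (rule ccontr)
    assume no: "\<not> ?thesis"
    define state where "state = (\<lambda>(S, xs). S \<subseteq> V \<and> set xs \<subseteq> V \<and> S \<inter> set xs = {} \<and> distinct xs \<and>
       successively R' xs \<and> (\<forall>x\<in>S. \<forall>u\<in>V - S - set xs. \<not> R' u x) \<and> (\<forall>c. card (S \<inter> P c) \<le> k c))"
    \<comment> \<open>Both moves raise this measure: pushing a vertex adds 1, and moving the top of
      the stack to \<open>S\<close> adds 2 and takes away 1. A maximal state is thus a search that
      is stuck.\<close>
    define meas where "meas = (\<lambda>(S :: 'a set, xs :: 'a list). 2 * card S + length xs)"
    have s0: "state ({}, [])" by (auto simp: state_def)
    have bnd: "meas s < Suc (2 * card V + L)" if "state s" for s
    proof -
      obtain S xs where s: "s = (S, xs)" by force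
      have "length xs \<le> L" "card S \<le> card V"
        using that no finV by (auto simp: s state_def not_less_eq_eq intro: card_mono)
      then show ?thesis by (simp add: s meas_def)
    qed
    obtain s where st: "state s" and mx: "\<And>s'. state s' \<Longrightarrow> meas s' \<le> meas s"
      using ex_has_greatest_nat[of state, OF s0, of meas] bnd by (metis less_imp_le)
    obtain S xs where s: "s = (S, xs)" by force
    define U where "U = V - S - set xs"
    have len: "length xs \<le> L" using no st by (auto simp: s state_def not_less_eq_eq)
    have finS: "finite S" using st finV by (auto simp: s state_def intro: finite_subset)
    have cover: "P c \<subseteq> (S \<inter> P c) \<union> set xs \<union> (U \<inter> P c)" for c
      using PV[of c] by (auto simp: U_def)
    have cardP: "card (P c) \<le> k c + L + card (U \<inter> P c)" for c
    proof -
      have "card (P c) \<le> card ((S \<inter> P c) \<union> set xs \<union> (U \<inter> P c))"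
        by (rule card_mono[OF _ cover]) (use fin in auto)
      also have "\<dots> \<le> card (S \<inter> P c) + card (set xs) + card (U \<inter> P c)"
        by (meson card_Un_le add_le_mono1 le_trans)
      also have "\<dots> \<le> k c + L + card (U \<inter> P c)"
        using st len card_length[of xs] unfolding s state_def by (simp add: add_mono)
      finally show ?thesis .
    qed
    show False
    proof (cases xs)
      case Nil
      show False
      proof (cases "U = {}")
        case True
        have "card (P True) \<le> card (S \<inter> P True)"
          using cover[of True] True Nil fin by (intro card_mono) auto
        also have "\<dots> \<le> k True" using st by (simp add: s state_def)
        finally show False using size[of True] L by simp
      next
        case False
        then obtain u where u: "u \<in> U" by blast
        have "state (S, [u])" using st u Nil by (auto simp: s state_def U_def)
        from mx[OF this] show False by (simp add: s Nil meas_def)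
      qed
    next
      case (Cons x ys)
      show False
      proof (cases "\<exists>u\<in>U. R' u x")
        case True
        then obtain u where u: "u \<in> U" "R' u x" by blast
        have "state (S, u # xs)" using st u Cons by (auto simp: s state_def U_def)
        from mx[OF this] show False by (simp add: s meas_def)
      next
        case noU: False
        have xS: "x \<notin> S" "x \<in> V" using st by (auto simp: s state_def Cons)
        have "\<not> state (insert x S, ys)"
        proof
          assume "state (insert x S, ys)"
          from mx[OF this] show False using xS finS by (simp add: s Cons meas_def)
        qed
        moreover have "insert x S \<subseteq> V \<and> set ys \<subseteq> V \<and> insert x S \<inter> set ys = {} \<and> distinct ys \<and>
            successively R' ys \<and> (\<forall>z\<in>insert x S. \<forall>u\<in>V - insert x S - set ys. \<not> R' u z)"
          using st noU unfolding s state_def Cons U_def by (auto simp: successively_Cons)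
        ultimately obtain c where c: "k c < card (insert x S \<inter> P c)"
          by (auto simp: state_def not_le)
        have "card (insert x S \<inter> P c) \<le> Suc (card (S \<inter> P c))"
          using finS by (cases "x \<in> P c") (auto simp: Int_insert_left card_insert_if)
        then have kS: "k c \<le> card (S \<inter> P c)" using c by simp
        \<comment> \<open>Side \<open>c\<close> of \<open>S\<close> is full and \<open>S\<close> has
          no edge to \<open>U\<close>, so \<open>U\<close> is small on the other side. But there
          \<open>S\<close> and the stack account for at most \<open>k (\<not> c) + L\<close> of at
          least \<open>2 * k (\<not> c) + L\<close> vertices.\<close>
        have "card (U \<inter> P (\<not> c)) < k (\<not> c)"
        proof (rule ccontr)
          assume "\<not> ?thesis"
          then have "\<exists>x\<in>S \<inter> P c. \<exists>y\<in>U \<inter> P (\<not> c). R' y x"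
            using kS by (intro joined') auto
          then show False using st by (auto simp: s state_def U_def)
        qed
        then show False using cardP[of "\<not> c"] size[of "\<not> c"] by simp
      qed
    qed
  qed
  then obtain xs where xs: "Suc L \<le> length xs" "distinct xs" "successively R' xs" "set xs \<subseteq> V" by blast
  define zs where "zs = (if hd xs \<in> P b then xs else tl xs)"
  obtain x y ys where xy: "xs = x # y # ys" using xs(1) L by (cases xs; cases "tl xs") auto
  have hz: "hd zs \<in> P b"
  proof (cases "x \<in> P b")
    case False
    moreover have "x \<in> P b \<or> x \<in> P (\<not> b)" using xs(4) by (cases b) (auto simp: xy V_def)
    moreover have "R' x y" using xs(3) by (simp add: xy)
    then obtain c where "x \<in> P c" "y \<in> P (\<not> c)" by (auto simp: R'_def)
    ultimately show ?thesis by (cases b; cases c) (auto simp: zs_def xy)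
  qed (simp add: zs_def xy)
  have lz: "L \<le> length zs" and dz: "distinct zs" and sz: "successively R' zs" "set zs \<subseteq> V"
    using xs by (auto simp: zs_def xy)
  show ?thesis
  proof (rule that[of "take L zs"])
    show "successively (\<lambda>x y. R x y \<and> (\<exists>c. x \<in> P c \<and> y \<in> P (\<not> c))) (take L zs)"
    proof -
      have "successively R' (take L zs @ drop L zs)" using sz by simp
      then show ?thesis unfolding R'_def successively_append_iff by blast
    qed
    show "hd (take L zs) \<in> P b" using hz L by simp
    show "set (take L zs) \<subseteq> P True \<union> P False" using sz(2) set_take_subset[of L zs] by (auto simp: V_def)
  qed (use lz dz in auto)
qed

text \<open>The boolean \<open>b = odd m\<close> is \<open>b\<close> for odd \<open>m\<close> and
  \<open>\<not> b\<close> for even \<open>m\<close>. Later \<open>b = even d\<close> names in the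
  same way the side reached at depth \<open>d\<close>, since such a path has \<open>Suc d\<close>
  vertices.\<close>

lemma last_alternating:
  assumes "successively (\<lambda>x y. R x y \<and> (\<exists>c. x \<in> W c \<and> y \<in> W (\<not> c))) xs"
    and "xs \<noteq> []" "hd xs \<in> W b" and disj: "W True \<inter> W False = {}"
  shows "last xs \<in> W (b = odd (length xs))"
  using assms(1-3)
proof (induction xs arbitrary: b)
  case (Cons x xs)
  show ?case
  proof (cases xs)
    case Nil
    then show ?thesis using Cons by simp
  next
    case (Cons y ys)
    then obtain c where c: "x \<in> W c" "y \<in> W (\<not> c)" using Cons.prems by auto
    have "c = b" using c Cons.prems(3) disj by (cases c; cases b) auto
    then have "last xs \<in> W ((\<not> b) = odd (length xs))"
      using Cons.IH[of "\<not> b"] Cons.prems c Cons by auto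
    moreover have "((\<not> b) = odd (length xs)) = (b = odd (length (x # xs)))" by auto
    ultimately show ?thesis using Cons by simp
  qed
qed simp

text \<open>Giving the vertices of side \<open>b\<close> the weight \<open>k (\<not> b)\<close> makes the two thresholds
  \<open>k True\<close> and \<open>k False\<close> equally heavy; this is what allows clusters of very different sizes.\<close>

lemma bipartite_layers:
  fixes W :: "bool \<Rightarrow> 'a set" and k :: "bool \<Rightarrow> nat"
  assumes fin: "\<And>b. finite (W b)" and disj: "W True \<inter> W False = {}"
    and sym: "\<And>x y. R x y \<Longrightarrow> R y x"
    and joined: "\<And>X Y. X \<subseteq> W True \<Longrightarrow> Y \<subseteq> W False \<Longrightarrow> k True \<le> card X \<Longrightarrow> k False \<le> card Y \<Longrightarrow>
                   \<exists>x\<in>X. \<exists>y\<in>Y. R x y"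
    and size: "\<And>b. 10 * k b \<le> card (W b)" and pos: "\<And>b. 0 < k b" and h: "\<And>b. 2 * k b \<le> 3 ^ h"
  obtains U where "\<And>b. card (U \<inter> W b) < 2 * k b"
    "\<And>b r. r \<in> W b \<Longrightarrow> r \<notin> U \<Longrightarrow> \<exists>d X. d \<le> h \<and> X \<subseteq> W (b = even d) \<and> k (b = even d) \<le> card X \<and>
       (\<forall>x\<in>X. \<exists>xs. length xs = Suc d \<and> hd xs = r \<and> last xs = x \<and> distinct xs \<and>
                      successively R xs \<and> set xs \<subseteq> W True \<union> W False)"
proof -
  define R' where "R' = (\<lambda>x y. R x y \<and> (\<exists>c. x \<in> W c \<and> y \<in> W (\<not> c)))"
  define V where "V = W True \<union> W False"
  \<comment> \<open>\<open>K\<close> is the weight of a set of threshold size, whichever side it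
    lies on.\<close>
  define K where "K = k True * k False"
  define w where "w v = (if v \<in> W True then k False else k True)" for v
  have finV: "finite V" using fin by (simp add: V_def)
  have WV: "W c \<subseteq> V" for c by (cases c) (auto simp: V_def)
  have Kc: "K = k c * k (\<not> c)" for c by (cases c) (auto simp: K_def)
  have wW: "w v = k (\<not> c)" if "v \<in> W c" for c v
    using that disj by (cases c) (auto simp: w_def)
  have sumW: "sum w T = k (\<not> c) * card T" if "T \<subseteq> W c" for T c
    using that wW[of _ c] by (subst sum.cong[of T T w "\<lambda>_. k (\<not> c)"]) auto
  have sumV: "sum w T = k (\<not> c) * card (T \<inter> W c) + k c * card (T \<inter> W (\<not> c))" if T: "T \<subseteq> V" for T c
  proof -
    have fT: "finite T" using T finV finite_subset by blast
    have "T = (T \<inter> W c) \<union> (T \<inter> W (\<not> c))" using T by (cases c) (auto simp: V_def)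
    then have "sum w T = sum w ((T \<inter> W c) \<union> (T \<inter> W (\<not> c)))" by simp
    also have "\<dots> = sum w (T \<inter> W c) + sum w (T \<inter> W (\<not> c))"
      by (rule sum.union_disjoint) (use fT disj in \<open>cases c; auto\<close>)+
    finally show ?thesis using sumW[of "T \<inter> W c" c] sumW[of "T \<inter> W (\<not> c)" "\<not> c"] by simp
  qed
  have joined': "\<exists>x\<in>X. \<exists>y\<in>Y. R x y" if "X \<subseteq> W c" "Y \<subseteq> W (\<not> c)" "k c \<le> card X" "k (\<not> c) \<le> card Y"
    for c X Y
  proof (cases c)
    case True
    then show ?thesis using joined[of X Y] that by auto
  next
    case False
    then have "\<exists>x\<in>Y. \<exists>y\<in>X. R x y" using joined[of Y X] that by auto
    then show ?thesis using sym by blast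
  qed
  \<comment> \<open>This needs the factor 10 in \<open>size\<close>. Some side \<open>c\<close> of
    \<open>T\<close> reaches its threshold, so all but fewer than \<open>k (\<not> c)\<close> of the
    opposite vertices, a weight above \<open>9 * K\<close>, lie in \<open>T\<close> or in its
    neighbourhood. If \<open>T\<close> is below its threshold there, it takes at most
    \<open>K\<close> of this, and the remaining \<open>8 * K\<close> exceed twice the weight of
    \<open>T\<close>, which is below \<open>4 * K\<close>. If both sides reach their thresholds, the
    two estimates are added.\<close>
  have big: "2 * sum w T < sum w (nbh R' V T)"
    if T: "T \<subseteq> V" "2 * K \<le> sum w T" "sum w T < 2 * (2 * K)" for T
  proof -
    let ?N = "nbh R' V T"
    have NV: "?N \<subseteq> V" by (auto simp: nbh_def)
    have near: "9 * k (\<not> c) < card (?N \<inter> W (\<not> c)) + card (T \<inter> W (\<not> c))"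
      if c: "k c \<le> card (T \<inter> W c)" for c
    proof -
      define Z where "Z = {y \<in> W (\<not> c). \<forall>x\<in>T \<inter> W c. \<not> R x y}"
      have "card Z < k (\<not> c)"
      proof (rule ccontr)
        assume "\<not> ?thesis"
        then have "\<exists>x\<in>T \<inter> W c. \<exists>y\<in>Z. R x y" using c by (intro joined') (auto simp: Z_def)
        then show False by (auto simp: Z_def)
      qed
      moreover have "W (\<not> c) \<subseteq> (?N \<inter> W (\<not> c)) \<union> (T \<inter> W (\<not> c)) \<union> Z"
        using WV[of "\<not> c"] by (auto simp: Z_def nbh_def R'_def)
      then have "card (W (\<not> c)) \<le> card ((?N \<inter> W (\<not> c)) \<union> (T \<inter> W (\<not> c)) \<union> Z)"
        by (rule card_mono[rotated]) (use fin in \<open>auto simp: Z_def\<close>)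
      then have "card (W (\<not> c)) \<le> card (?N \<inter> W (\<not> c)) + card (T \<inter> W (\<not> c)) + card Z"
        by (meson card_Un_le add_le_mono1 le_trans)
      ultimately show ?thesis using size[of "\<not> c"] by linarith
    qed
    have near': "9 * K + k c \<le> k c * card (?N \<inter> W (\<not> c)) + k c * card (T \<inter> W (\<not> c))"
      if c: "k c \<le> card (T \<inter> W c)" for c
    proof -
      have "k c * (9 * k (\<not> c) + 1) \<le> k c * (card (?N \<inter> W (\<not> c)) + card (T \<inter> W (\<not> c)))"
        using near[OF c] by (intro mult_le_mono2) simp
      then show ?thesis by (simp add: Kc[of c] algebra_simps)
    qed
    have "\<exists>c. k c \<le> card (T \<inter> W c)"
    proof (rule ccontr)
      assume "\<nexists>c. k c \<le> card (T \<inter> W c)"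
      then have lt: "card (T \<inter> W c) < k c" for c by (simp add: not_le)
      have "k (\<not> c) * card (T \<inter> W c) < k (\<not> c) * k c" for c using lt[of c] pos by simp
      from add_strict_mono[OF this[of True] this[of False]] have "sum w T < K + K"
        unfolding sumV[OF T(1), of True] by (simp add: K_def mult.commute)
      then show False using T(2) by simp
    qed
    then obtain c where c: "k c \<le> card (T \<inter> W c)" by blast
    show ?thesis
    proof (cases "k (\<not> c) \<le> card (T \<inter> W (\<not> c))")
      case True
      have "18 * K < sum w ?N + sum w T"
        using near'[OF c] near'[OF True] pos[of c] sumV[OF NV, of c] sumV[OF T(1), of c] by simp
      then show ?thesis using T(3) by simp
    next
      case False
      then have "k c * card (T \<inter> W (\<not> c)) \<le> K" by (simp add: Kc[of c])
      then have "8 * K < sum w ?N" using near'[OF c] pos[of c] sumV[OF NV, of c] by simp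
      then show ?thesis using T(3) by simp
    qed
  qed
  have Q: "0 < 2 * K" using pos by (simp add: K_def)
  obtain U where U: "U \<subseteq> V" "sum w U < 2 * K" and
    ex: "\<And>S. S \<subseteq> V - U \<Longrightarrow> S \<noteq> {} \<Longrightarrow> sum w S < 2 * K \<Longrightarrow> 2 * sum w S < sum w (nbh R' (V - U) S)"
    using expanding_subset[OF finV Q big] by blast
  show ?thesis
  proof (rule that[of U])
    fix b
    have "k (\<not> b) * (2 * k b) = 2 * K" by (simp add: Kc[of b])
    then have "k (\<not> b) * card (U \<inter> W b) < k (\<not> b) * (2 * k b)"
      using sumV[OF U(1), of b] U(2) by linarith
    then show "card (U \<inter> W b) < 2 * k b" by simp
  next
    fix b r assume r: "r \<in> W b" "r \<notin> U"
    have rV: "r \<in> V - U" "0 < w r" using r WV[of b] pos by (auto simp: w_def)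
    have finVU: "finite (V - U)" using finV by simp
    obtain d X where X: "X \<subseteq> V - U" "2 * (2 * K) \<le> 3 * sum w X" and
      d: "d = 0 \<or> 3 ^ (d - 1) * w r < 2 * K" and
      paths: "\<And>x. x \<in> X \<Longrightarrow> \<exists>xs. length xs = Suc d \<and> hd xs = r \<and> last xs = x \<and> distinct xs \<and>
                      successively R' xs \<and> set xs \<subseteq> V - U"
    proof (rule bfs_layer[of "V - U" r w "2 * K" R', OF finVU rV])
      show "2 * sum w S < sum w (nbh R' (V - U) S)" if "S \<subseteq> V - U" "S \<noteq> {}" "sum w S < 2 * K" for S
        using that by (rule ex)
    qed (rule that)
    define c where "c = (b = even d)"
    have XW: "X \<subseteq> W c"
    proof
      fix x assume "x \<in> X"
      then obtain xs where "length xs = Suc d" "hd xs = r" "last xs = x" "successively R' xs"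
        using paths by blast
      then show "x \<in> W c"
        using last_alternating[of R W xs b] disj r unfolding R'_def c_def by force
    qed
    have "k (\<not> c) * (4 * k c) \<le> k (\<not> c) * (3 * card X)"
      using X(2) sumW[OF XW] by (simp add: Kc[of c] algebra_simps)
    then have "4 * k c \<le> 3 * card X" using pos by simp
    then have cX: "k c \<le> card X" by simp
    \<comment> \<open>The root weighs \<open>k (\<not> b)\<close>; dividing by it turns the bound
      \<open>2 * K\<close> into \<open>2 * k b\<close>. The depth is thus governed by one threshold
      and not by the product of both.\<close>
    have "d \<le> h"
      using d
    proof
      assume "3 ^ (d - 1) * w r < 2 * K"
      then have "k (\<not> b) * 3 ^ (d - 1) < k (\<not> b) * (2 * k b)"
        using wW[OF r(1)] by (simp add: Kc[of b] algebra_simps)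
      then have "3 ^ (d - 1) < 2 * k b" by simp
      also have "\<dots> \<le> 3 ^ h" by (rule h)
      finally have "(3::nat) ^ (d - 1) < 3 ^ h" .
      then have "d - 1 < h" by (rule power_less_imp_less_exp[rotated]) simp
      then show ?thesis by simp
    qed simp
    moreover have "\<forall>x\<in>X. \<exists>xs. length xs = Suc d \<and> hd xs = r \<and> last xs = x \<and> distinct xs \<and>
                      successively R xs \<and> set xs \<subseteq> W True \<union> W False"
    proof
      fix x assume "x \<in> X"
      then obtain xs where xs: "length xs = Suc d" "hd xs = r" "last xs = x" "distinct xs"
          "successively R' xs" "set xs \<subseteq> V - U"
        using paths by blast
      have "successively R xs" using xs(5) by (rule successively_mono) (simp add: R'_def)
      then show "\<exists>xs. length xs = Suc d \<and> hd xs = r \<and> last xs = x \<and> distinct xs \<and>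
                      successively R xs \<and> set xs \<subseteq> W True \<union> W False"
        using xs by (auto simp: V_def)
    qed
    ultimately show "\<exists>d X. d \<le> h \<and> X \<subseteq> W (b = even d) \<and> k (b = even d) \<le> card X \<and>
       (\<forall>x\<in>X. \<exists>xs. length xs = Suc d \<and> hd xs = r \<and> last xs = x \<and> distinct xs \<and>
                      successively R xs \<and> set xs \<subseteq> W True \<union> W False)"
      using XW cX unfolding c_def by blast
  qed
qed

text \<open>Each side is cut into \<open>S\<close> and \<open>T\<close> of size
  \<open>10 * k\<close> and a rest \<open>P\<close> of size at least \<open>5 * k\<close>, whence
  25. A tree in \<open>S\<close> grown from \<open>a\<close> and a tree in \<open>T\<close> grown
  from \<open>b\<close> reach depths that cannot be prescribed, but the path through
  \<open>P\<close> that connects them may have any length and makes up the difference.\<close>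

lemma bipartite_paths:
  fixes V :: "bool \<Rightarrow> 'a set" and k :: "bool \<Rightarrow> nat"
  assumes fin: "\<And>b. finite (V b)" and disj: "V True \<inter> V False = {}"
    and sym: "\<And>x y. R x y \<Longrightarrow> R y x"
    and joined: "\<And>X Y. X \<subseteq> V True \<Longrightarrow> Y \<subseteq> V False \<Longrightarrow> k True \<le> card X \<Longrightarrow> k False \<le> card Y \<Longrightarrow>
                   \<exists>x\<in>X. \<exists>y\<in>Y. R x y"
    and size: "\<And>b. 25 * k b \<le> card (V b)" and n: "0 < n" "\<And>b. n \<le> k b" and h: "\<And>b. 2 * k b \<le> 3 ^ h"
  obtains A B where "A \<subseteq> V True" "B \<subseteq> V False" "k True \<le> card A" "k False \<le> card B"
    "\<And>a b l. a \<in> A \<Longrightarrow> b \<in> B \<Longrightarrow> even l \<Longrightarrow> 2 * h + 3 \<le> l \<Longrightarrow> l \<le> n \<Longrightarrow>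
       \<exists>xs. length xs = l \<and> hd xs = a \<and> last xs = b \<and> distinct xs \<and> successively R xs \<and>
            set xs \<subseteq> V True \<union> V False"
proof -
  have pos: "0 < k b" for b using n(1) n(2)[of b] by simp
  have "\<exists>X Y. X \<subseteq> V b \<and> Y \<subseteq> V b - X \<and> card X = 10 * k b \<and> card Y = 10 * k b" for b
  proof -
    obtain X where X: "X \<subseteq> V b" "card X = 10 * k b"
      using obtain_subset_with_card_n[of "10 * k b" "V b"] size[of b] by auto
    have "card (V b - X) = card (V b) - 10 * k b"
      using X fin by (simp add: card_Diff_subset finite_subset)
    then have "10 * k b \<le> card (V b - X)" using size[of b] by simp
    then obtain Y where "Y \<subseteq> V b - X" "card Y = 10 * k b"
      using obtain_subset_with_card_n[of "10 * k b" "V b - X"] by blast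
    then show ?thesis using X by blast
  qed
  then obtain S T where ST: "\<And>b. S b \<subseteq> V b" "\<And>b. T b \<subseteq> V b - S b" "\<And>b. card (S b) = 10 * k b"
      "\<And>b. card (T b) = 10 * k b" by metis
  define P where "P b = V b - S b - T b" for b
  have finST: "finite (S b)" "finite (T b)" "finite (P b)" for b
    using ST(1)[of b] ST(2)[of b] fin[of b] by (auto simp: P_def intro: rev_finite_subset)
  have sizeP: "5 * k b \<le> card (P b)" for b
  proof -
    have "V b = P b \<union> (S b \<union> T b)" using ST[of b] by (auto simp: P_def)
    then have "card (V b) \<le> card (P b) + card (S b \<union> T b)" by (metis card_Un_le)
    also have "\<dots> \<le> card (P b) + (card (S b) + card (T b))" using card_Un_le[of "S b" "T b"] by simp
    finally show ?thesis using ST(3,4)[of b] size[of b] by simp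
  qed
  have sub: "T b \<subseteq> V b" "P b \<subseteq> V b" for b using ST(2)[of b] by (auto simp: P_def)
  obtain U2 where U2: "\<And>b. card (U2 \<inter> S b) < 2 * k b" and
    layer2: "\<And>b r. r \<in> S b \<Longrightarrow> r \<notin> U2 \<Longrightarrow> \<exists>d X. d \<le> h \<and> X \<subseteq> S (b = even d) \<and> k (b = even d) \<le> card X \<and>
       (\<forall>x\<in>X. \<exists>xs. length xs = Suc d \<and> hd xs = r \<and> last xs = x \<and> distinct xs \<and>
                      successively R xs \<and> set xs \<subseteq> S True \<union> S False)"
  proof (rule bipartite_layers[of S R k h])
    show "S True \<inter> S False = {}" using ST disj by blast
    show "\<exists>x\<in>X. \<exists>y\<in>Y. R x y" if "X \<subseteq> S True" "Y \<subseteq> S False" "k True \<le> card X" "k False \<le> card Y" for X Y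
      using that ST(1) by (intro joined) auto
  qed (use finST sym ST pos h in auto)
  obtain U3 where U3: "\<And>b. card (U3 \<inter> T b) < 2 * k b" and
    layer3: "\<And>b r. r \<in> T b \<Longrightarrow> r \<notin> U3 \<Longrightarrow> \<exists>d X. d \<le> h \<and> X \<subseteq> T (b = even d) \<and> k (b = even d) \<le> card X \<and>
       (\<forall>x\<in>X. \<exists>xs. length xs = Suc d \<and> hd xs = r \<and> last xs = x \<and> distinct xs \<and>
                      successively R xs \<and> set xs \<subseteq> T True \<union> T False)"
  proof (rule bipartite_layers[of T R k h])
    show "T True \<inter> T False = {}" using sub disj by blast
    show "\<exists>x\<in>X. \<exists>y\<in>Y. R x y" if "X \<subseteq> T True" "Y \<subseteq> T False" "k True \<le> card X" "k False \<le> card Y" for X Y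
      using that sub by (intro joined) auto
  qed (use finST sym ST pos h in auto)
  have joined': "\<exists>x\<in>X. \<exists>y\<in>Y. R x y" if "X \<subseteq> V c" "Y \<subseteq> V (\<not> c)" "k c \<le> card X" "k (\<not> c) \<le> card Y"
    for c X Y
  proof (cases c)
    case True
    then show ?thesis using joined[of X Y] that by auto
  next
    case False
    then have "\<exists>x\<in>Y. \<exists>y\<in>X. R x y" using joined[of Y X] that by auto
    then show ?thesis using sym by blast
  qed
  define A where "A = S True - U2"
  define B where "B = T False - U3"
  have few: "card {v \<in> P (\<not> c). \<forall>x\<in>X. \<not> R x v} \<le> k (\<not> c)" if X: "X \<subseteq> V c" "k c \<le> card X" for c X
  proof (rule ccontr)
    assume "\<not> ?thesis"
    then have "\<exists>x\<in>X. \<exists>y\<in>{v \<in> P (\<not> c). \<forall>x\<in>X. \<not> R x v}. R x y"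
      using X sub(2)[of "\<not> c"] by (intro joined') auto
    then show False by auto
  qed
  have main: "\<exists>xs. length xs = l \<and> hd xs = a \<and> last xs = b \<and> distinct xs \<and> successively R xs \<and>
            set xs \<subseteq> V True \<union> V False"
    if a: "a \<in> A" and b: "b \<in> B" and l: "even l" "2 * h + 3 \<le> l" "l \<le> n" for a b l
  proof -
    obtain d2 X2 where d2: "d2 \<le> h" and X2: "X2 \<subseteq> S (even d2)" "k (even d2) \<le> card X2"
      and p2: "\<And>x. x \<in> X2 \<Longrightarrow> \<exists>xs. length xs = Suc d2 \<and> hd xs = a \<and> last xs = x \<and> distinct xs \<and>
                      successively R xs \<and> set xs \<subseteq> S True \<union> S False"
      using layer2[of a True] a by (auto simp: A_def)
    obtain d3 X3 where d3: "d3 \<le> h" and X3: "X3 \<subseteq> T (odd d3)" "k (odd d3) \<le> card X3"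
      and p3: "\<And>x. x \<in> X3 \<Longrightarrow> \<exists>xs. length xs = Suc d3 \<and> hd xs = b \<and> last xs = x \<and> distinct xs \<and>
                      successively R xs \<and> set xs \<subseteq> T True \<union> T False"
      using layer3[of b False] b by (auto simp: B_def)
    \<comment> \<open>Depth \<open>d\<close> means \<open>Suc d\<close> vertices, hence the 2;
      \<open>2 * h + 3 \<le> l\<close> leaves at least one vertex for the middle path.\<close>
    define L where "L = l - d2 - d3 - 2"
    have L: "0 < L" "L \<le> n" "l = Suc d2 + L + Suc d3" using l d2 d3 by (auto simp: L_def)
    define Z2 where "Z2 = {v \<in> P (\<not> even d2). \<forall>x\<in>X2. \<not> R x v}"
    define Z3 where "Z3 = {v \<in> P (\<not> odd d3). \<forall>x\<in>X3. \<not> R x v}"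
    \<comment> \<open>Without the vertices that have no neighbour in \<open>X2\<close> or
      \<open>X3\<close>, whatever ends the middle path has will attach to the two trees. Each side
      loses at most \<open>2 * k c\<close> of at least \<open>5 * k c\<close> vertices, and the rest
      covers \<open>2 * k c + L\<close> because \<open>L \<le> n \<le> k c\<close>.\<close>
    define P' where "P' c = P c - Z2 - Z3" for c
    have disjP: "P True \<inter> P False = {}" using sub disj by blast
    have X2V: "X2 \<subseteq> V (even d2)" and X3V: "X3 \<subseteq> V (odd d3)" using X2 X3 ST(1) sub by blast+
    have Z2c: "card (Z2 \<inter> P c) \<le> k c" for c
    proof (cases "c = (\<not> even d2)")
      case True
      then have "Z2 \<inter> P c = Z2" by (auto simp: Z2_def)
      then show ?thesis using few[OF X2V X2(2)] True by (simp add: Z2_def)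
    next
      case False
      then have "Z2 \<inter> P c = {}" using disjP by (cases c) (auto simp: Z2_def)
      then show ?thesis by simp
    qed
    have Z3c: "card (Z3 \<inter> P c) \<le> k c" for c
    proof (cases "c = (\<not> odd d3)")
      case True
      then have "Z3 \<inter> P c = Z3" by (auto simp: Z3_def)
      then show ?thesis using few[OF X3V X3(2)] True by (simp add: Z3_def)
    next
      case False
      then have "Z3 \<inter> P c = {}" using disjP by (cases c) (auto simp: Z3_def)
      then show ?thesis by simp
    qed
    have sizeP': "2 * k c + L \<le> card (P' c)" for c
    proof -
      have "P c = P' c \<union> ((Z2 \<inter> P c) \<union> (Z3 \<inter> P c))" by (auto simp: P'_def)
      then have "card (P c) \<le> card (P' c) + card ((Z2 \<inter> P c) \<union> (Z3 \<inter> P c))" by (metis card_Un_le)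
      also have "\<dots> \<le> card (P' c) + (card (Z2 \<inter> P c) + card (Z3 \<inter> P c))"
        by (simp add: card_Un_le)
      finally show ?thesis using Z2c[of c] Z3c[of c] sizeP[of c] L(2) n(2)[of c] by simp
    qed
    have P'P: "P' c \<subseteq> P c" for c by (auto simp: P'_def)
    obtain xs where xs: "length xs = L" "distinct xs" "hd xs \<in> P' (odd d2)" "set xs \<subseteq> P' True \<union> P' False"
      and sxs: "successively (\<lambda>x y. R x y \<and> (\<exists>c. x \<in> P' c \<and> y \<in> P' (\<not> c))) xs"
    proof (rule alternating_path[of P' R k L "odd d2"])
      show "P' True \<inter> P' False = {}" using P'P disjP by blast
      show "\<exists>x\<in>X. \<exists>y\<in>Y. R x y" if "X \<subseteq> P' True" "Y \<subseteq> P' False" "k True \<le> card X" "k False \<le> card Y" for X Y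
        using that sub P'P by (intro joined) blast+
    qed (use finST sym sizeP' L in \<open>auto simp: P'_def\<close>)
    have xne: "xs \<noteq> []" using xs(1) L(1) by auto
    have "last xs \<in> P' (odd d2 = odd (length xs))"
      by (rule last_alternating[OF sxs xne xs(3)]) (use P'P disjP in blast)
    \<comment> \<open>The evenness of \<open>l\<close> puts the end of the middle path on the side
      opposite to the layer \<open>X3\<close>.\<close>
    moreover have "(odd d2 = odd (length xs)) = even d3"
      using l(1) unfolding xs(1) L(3) by auto
    ultimately have lst: "last xs \<in> P' (even d3)" by simp
    obtain x2 where x2: "x2 \<in> X2" "R x2 (hd xs)" using xs(3) by (auto simp: P'_def Z2_def)
    obtain x3 where x3: "x3 \<in> X3" "R x3 (last xs)" using lst by (auto simp: P'_def Z3_def)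
    obtain ys where ys: "length ys = Suc d2" "hd ys = a" "last ys = x2" "distinct ys"
        "successively R ys" "set ys \<subseteq> S True \<union> S False" using p2[OF x2(1)] by blast
    obtain zs where zs: "length zs = Suc d3" "hd zs = b" "last zs = x3" "distinct zs"
        "successively R zs" "set zs \<subseteq> T True \<union> T False" using p3[OF x3(1)] by blast
    have ne: "ys \<noteq> []" "zs \<noteq> []" using ys(1) zs(1) by auto
    have "successively R (rev zs)"
      unfolding successively_rev using zs(5) by (rule successively_mono) (rule sym)
    moreover have "successively R xs" using sxs by (rule successively_mono) simp
    moreover have "R (last xs) (hd (rev zs))" using x3 sym zs(3) ne by (simp add: hd_rev)
    ultimately have "successively R (ys @ xs @ rev zs)"
      using ys(3,5) x2(2) xne ne by (auto simp: successively_append_iff)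
    moreover have "distinct (ys @ xs @ rev zs)"
    proof -
      have SP: "S c \<inter> P' e = {}" "S c \<inter> T e = {}" "P' c \<inter> T e = {}" for c e
        using ST(1)[of c] ST(2)[of e] sub[of c] P'P[of e] P'P[of c] sub[of e] disj
        by (cases c; cases e; auto simp: P_def)+
      have "set ys \<inter> set xs = {}" "set ys \<inter> set zs = {}" "set xs \<inter> set zs = {}"
        using ys(6) xs(4) zs(6) SP by blast+
      then show ?thesis using ys(4) xs(2) zs(4) by auto
    qed
    moreover have "set (ys @ xs @ rev zs) \<subseteq> V True \<union> V False"
    proof -
      have "S c \<subseteq> V True \<union> V False" "T c \<subseteq> V True \<union> V False" "P' c \<subseteq> V True \<union> V False" for c
        using ST(1)[of c] sub[of c] P'P[of c] by (cases c; auto)+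
      then show ?thesis using ys(6) xs(4) zs(6) by auto blast+
    qed
    moreover have "hd (ys @ xs @ rev zs) = a" "last (ys @ xs @ rev zs) = b"
      using ys(2) zs(2) ne by (auto simp: last_rev)
    moreover have "length (ys @ xs @ rev zs) = l" using ys(1) xs(1) zs(1) L(3) by simp
    ultimately show ?thesis by blast
  qed
  show ?thesis
  proof (rule that[of A B])
    show "A \<subseteq> V True" "B \<subseteq> V False" using ST(1) sub by (auto simp: A_def B_def)
    have "card (S True) \<le> card A + card (U2 \<inter> S True)"
      unfolding A_def by (metis Un_Diff_Int card_Un_le inf_commute)
    then show "k True \<le> card A" using U2[of True] ST(3)[of True] by simp
    have "card (T False) \<le> card B + card (U3 \<inter> T False)"
      unfolding B_def by (metis Un_Diff_Int card_Un_le inf_commute)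
    then show "k False \<le> card B" using U3[of False] ST(4)[of False] by simp
  qed (rule main)
qed

section \<open>Cycles through joined clusters\<close>

text \<open>Each side has its own threshold because clusters that were cut a different number of
  times have different sizes.\<close>

definition joined :: "('a \<Rightarrow> 'a \<Rightarrow> bool) \<Rightarrow> 'a set \<Rightarrow> nat \<Rightarrow> 'a set \<Rightarrow> nat \<Rightarrow> bool" where
  "joined R A k B l \<longleftrightarrow> (\<forall>X Y. X \<subseteq> A \<longrightarrow> Y \<subseteq> B \<longrightarrow> k \<le> card X \<longrightarrow> l \<le> card Y \<longrightarrow> (\<exists>x\<in>X. \<exists>y\<in>Y. R x y))"

definition closed_walk :: "('a \<Rightarrow> 'a \<Rightarrow> bool) \<Rightarrow> 'a list \<Rightarrow> bool" where
  "closed_walk R xs \<longleftrightarrow> xs \<noteq> [] \<and> successively R xs \<and> R (last xs) (hd xs)"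

text \<open>The reached part of each cluster stays above its threshold: fewer than
  \<open>k j\<close> vertices of the next cluster have no neighbour in the current part, so of
  \<open>2 * k j\<close> at least \<open>k j\<close> are reached.\<close>

lemma linking_path:
  assumes "successively (\<lambda>i j. joined R (X i) (k i) (X j) (k j)) is" "2 \<le> length is"
    and "\<And>i. i \<in> set is \<Longrightarrow> finite (X i) \<and> 2 * k i \<le> card (X i)"
    and "S \<subseteq> X (hd is)" "k (hd is) \<le> card S" and T: "T \<subseteq> X (last is)" "k (last is) \<le> card T"
  shows "\<exists>vs. list_all2 (\<lambda>v i. v \<in> X i) vs is \<and> hd vs \<in> S \<and> last vs \<in> T \<and> successively R vs"
  using assms
proof (induction "is" arbitrary: S)
  case (Cons i js)
  then obtain j ks where js: "js = j # ks" by (cases js) auto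
  have J: "joined R (X i) (k i) (X j) (k j)" using Cons.prems(1) by (simp add: js)
  show ?case
  proof (cases ks)
    case Nil
    then obtain x y where "x \<in> S" "y \<in> T" "R x y"
      using J[unfolded joined_def, rule_format, of S T] Cons.prems(4-7) unfolding js Nil by auto
    moreover have "S \<subseteq> X i" "T \<subseteq> X j" using Cons.prems(4,6) by (auto simp: js Nil)
    ultimately have "list_all2 (\<lambda>v i. v \<in> X i) [x, y] (i # js) \<and> hd [x, y] \<in> S \<and> last [x, y] \<in> T
        \<and> successively R [x, y]"
      by (auto simp: js Nil)
    then show ?thesis by blast
  next
    case (Cons m ms)
    define S' where "S' = {y \<in> X j. \<exists>x\<in>S. R x y}"
    have fj: "finite (X j)" "2 * k j \<le> card (X j)" using Cons.prems(3)[of j] by (auto simp: js)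
    have "card (X j - S') < k j"
    proof (rule ccontr)
      assume "\<not> ?thesis"
      then have "\<exists>x\<in>S. \<exists>y\<in>X j - S'. R x y"
        using J[unfolded joined_def, rule_format, of S "X j - S'"] Cons.prems(4,5) by auto
      then show False by (auto simp: S'_def)
    qed
    moreover have "card (X j - S') = card (X j) - card S'" "card S' \<le> card (X j)"
      using fj by (auto simp: S'_def card_Diff_subset intro: card_mono)
    ultimately have "k j \<le> card S'" using fj by linarith
    moreover have "S' \<subseteq> X j" by (auto simp: S'_def)
    ultimately obtain vs where vs: "list_all2 (\<lambda>v i. v \<in> X i) vs js" "hd vs \<in> S'" "last vs \<in> T"
        "successively R vs"
      using Cons.IH[of S'] Cons.prems(1-3,6,7) unfolding js Cons by auto
    obtain x where x: "x \<in> S" "R x (hd vs)" using vs(2) by (auto simp: S'_def)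
    have ne: "vs \<noteq> []" using vs(1) by (auto simp: js)
    show ?thesis
      using vs x ne Cons.prems(4)
      by (intro exI[of _ "x # vs"]) (auto simp: successively_Cons)
  qed
qed simp

lemma distinct_transversal:
  assumes "list_all2 (\<lambda>v i. v \<in> X i) vs is" "distinct is"
    and disj: "\<And>i j. i \<in> set is \<Longrightarrow> j \<in> set is \<Longrightarrow> i \<noteq> j \<Longrightarrow> X i \<inter> X j = {}"
  shows "distinct vs"
  unfolding distinct_conv_nth
proof (intro allI impI)
  fix a b assume ab: "a < length vs" "b < length vs" "a \<noteq> b"
  then have "vs ! a \<in> X (is ! a)" "vs ! b \<in> X (is ! b)" "length vs = length is"
    using assms(1) by (auto simp: list_all2_conv_all_nth)
  moreover from this have "X (is ! a) \<inter> X (is ! b) = {}"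
    using ab assms(2) by (intro disj) (auto simp: nth_eq_iff_index_eq)
  ultimately show "vs ! a \<noteq> vs ! b" by auto
qed

text \<open>A short path visits every cluster once, from the first to the last; a long path inside
  these two clusters, which are joined by the closing pair, completes the cycle. Its length
  \<open>l - (length is - 2)\<close> is even by the parity assumption. The long path works for all
  end vertices in \<open>A\<close> and \<open>B\<close>, so the short one can be chosen afterwards
  with ends there. Only the first and the last cluster need the factor 25; the others are merely
  passed through.\<close>

lemma cluster_cycle:
  fixes X :: "'i \<Rightarrow> 'a set"
  assumes sym: "\<And>x y. R x y \<Longrightarrow> R y x"
    and dist: "distinct is" and len: "2 \<le> length is"
    and disj: "\<And>i j. i \<in> set is \<Longrightarrow> j \<in> set is \<Longrightarrow> i \<noteq> j \<Longrightarrow> X i \<inter> X j = {}"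
    and J: "closed_walk (\<lambda>i j. joined R (X i) (k i) (X j) (k j)) is"
    and fin: "\<And>i. i \<in> set is \<Longrightarrow> finite (X i)"
    and size: "\<And>i. i \<in> set is \<Longrightarrow> 2 * k i \<le> card (X i)"
    and core: "\<And>i. i \<in> {hd is, last is} \<Longrightarrow> 25 * k i \<le> card (X i) \<and> n \<le> k i \<and> 2 * k i \<le> 3 ^ h"
    and l: "even (l + length is)" "2 * h + 3 + length is \<le> l" "l \<le> n"
  shows "\<exists>xs. length xs = l \<and> distinct xs \<and> closed_walk R xs"
proof -
  obtain p ms q where pq: "is = p # ms @ [q]"
    using len by (cases "is"; cases "tl is" rule: rev_cases) auto
  have pne: "p \<noteq> q" using dist by (simp add: pq)
  define V where "V b = (if b then X p else X q)" for b
  define k' where "k' b = (if b then k p else k q)" for b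
  have Jqp: "joined R (X q) (k q) (X p) (k p)" using J by (simp add: closed_walk_def pq)
  obtain A B where A: "A \<subseteq> X p" "k p \<le> card A" and B: "B \<subseteq> X q" "k q \<le> card B"
    and paths: "\<And>a b l. a \<in> A \<Longrightarrow> b \<in> B \<Longrightarrow> even l \<Longrightarrow> 2 * h + 3 \<le> l \<Longrightarrow> l \<le> n \<Longrightarrow>
       \<exists>xs. length xs = l \<and> hd xs = a \<and> last xs = b \<and> distinct xs \<and> successively R xs \<and>
            set xs \<subseteq> X p \<union> X q"
  proof (rule bipartite_paths[of V R k' n h])
    show "finite (V b)" for b using fin by (simp add: V_def pq)
    show "V True \<inter> V False = {}" using disj[of p q] pne by (simp add: V_def pq)
    show "\<exists>x\<in>X. \<exists>y\<in>Y. R x y"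
      if "X \<subseteq> V True" "Y \<subseteq> V False" "k' True \<le> card X" "k' False \<le> card Y" for X Y
    proof -
      have "\<exists>x\<in>Y. \<exists>y\<in>X. R x y" using Jqp that unfolding joined_def V_def k'_def by auto
      then show ?thesis using sym by blast
    qed
    show "25 * k' b \<le> card (V b)" "n \<le> k' b" "2 * k' b \<le> 3 ^ h" for b
      using core by (auto simp: V_def k'_def pq)
    show "0 < n" using l by simp
  next
    fix A B assume AB: "A \<subseteq> V True" "B \<subseteq> V False" "k' True \<le> card A" "k' False \<le> card B"
      and pth: "\<And>a b l. a \<in> A \<Longrightarrow> b \<in> B \<Longrightarrow> even l \<Longrightarrow> 2 * h + 3 \<le> l \<Longrightarrow> l \<le> n \<Longrightarrow>
       \<exists>xs. length xs = l \<and> hd xs = a \<and> last xs = b \<and> distinct xs \<and> successively R xs \<and>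
            set xs \<subseteq> V True \<union> V False"
    have V: "V True = X p" "V False = X q" "k' True = k p" "k' False = k q"
      by (auto simp: V_def k'_def)
    show thesis
      by (rule that[of A B]) (use AB in \<open>simp_all only: V\<close>, rule pth[unfolded V])
  qed (rule sym)
  obtain vs where vs: "list_all2 (\<lambda>v i. v \<in> X i) vs is" "hd vs \<in> A" "last vs \<in> B" "successively R vs"
    using linking_path[of R X k "is" A B] J len fin size A B by (auto simp: closed_walk_def pq)
  obtain a mid b where ab: "vs = a # mid @ [b]" and mid: "list_all2 (\<lambda>v i. v \<in> X i) mid ms"
    using vs(1) unfolding pq by (auto simp: list_all2_Cons2 list_all2_append2 list_all2_Nil2)
  have lenmid: "length mid = length ms" using mid by (rule list_all2_lengthD)
  define l' where "l' = l - length ms"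
  have l': "even l'" "2 * h + 3 \<le> l'" "l' \<le> n" "l = l' + length ms" using l by (auto simp: l'_def pq)
  obtain xs where xs: "length xs = l'" "hd xs = a" "last xs = b" "distinct xs" "successively R xs"
      "set xs \<subseteq> X p \<union> X q"
    using paths[of a b l'] l' vs(2,3) by (auto simp: ab)
  have midX: "\<exists>i\<in>set ms. v \<in> X i" if v: "v \<in> set mid" for v
  proof -
    obtain a where a: "a < length mid" "v = mid ! a" using v by (auto simp: in_set_conv_nth)
    then have "v \<in> X (ms ! a)" "ms ! a \<in> set ms" using mid by (auto simp: list_all2_conv_all_nth)
    then show ?thesis by blast
  qed
  have distmid: "distinct mid"
  proof (rule distinct_transversal[where X = X, OF mid])
    show "distinct ms" using dist by (simp add: pq)
    show "X i \<inter> X j = {}" if "i \<in> set ms" "j \<in> set ms" "i \<noteq> j" for i j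
      by (rule disj) (use that in \<open>simp_all add: pq\<close>)
  qed
  have sep: "set xs \<inter> set mid = {}"
  proof (rule ccontr)
    assume "set xs \<inter> set mid \<noteq> {}"
    then obtain v where v: "v \<in> set mid" "v \<in> X p \<union> X q" using xs(6) by blast
    then obtain i where "i \<in> set ms" "v \<in> X i" using midX by blast
    then show False using v(2) disj[of p i] disj[of q i] dist by (auto simp: pq)
  qed
  have xne: "xs \<noteq> []" using xs(1) l'(2) by auto
  have sm: "successively R (a # mid @ [b])" using vs(4) by (simp add: ab)
  have "successively R (rev (a # mid @ [b]))"
    unfolding successively_rev using sm by (rule successively_mono) (rule sym)
  then have sr: "successively R (b # rev mid @ [a])" by simp
  then have "closed_walk R (xs @ rev mid)"
    using xs(2,3,5) xne unfolding closed_walk_def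
    by (cases "rev mid" rule: rev_cases)
       (auto simp: successively_append_iff successively_Cons hd_append split: if_splits)
  then show ?thesis
    using xs(1,4) distmid sep lenmid l'(4) by (intro exI[of _ "xs @ rev mid"]) auto
qed

section \<open>Odd cycles and independent sets in the graph of clusters\<close>

lemma odd_closed_walk_imp_odd_cycle:
  assumes "closed_walk G xs" "odd (length xs)"
  shows "\<exists>ys. closed_walk G ys \<and> odd (length ys) \<and> distinct ys \<and> set ys \<subseteq> set xs"
  using assms
proof (induction "length xs" arbitrary: xs rule: less_induct)
  case less
  show ?case
  proof (cases "distinct xs")
    case False
    \<comment> \<open>Cutting at a repeated vertex gives two shorter closed walks whose lengths add
      up to an odd number, so one of them is odd.\<close>
    then obtain as bs cs y where xs: "xs = as @ [y] @ bs @ [y] @ cs"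
      using not_distinct_decomp by blast
    have 1: "closed_walk G (y # bs)"
      using less.prems(1) unfolding xs closed_walk_def
      by (cases bs) (auto simp: successively_append_iff successively_Cons)
    have 2: "closed_walk G (as @ y # cs)"
      using less.prems(1) unfolding xs closed_walk_def
      by (cases as) (auto simp: successively_append_iff successively_Cons hd_append split: if_splits)
    have "odd (length (y # bs)) \<or> odd (length (as @ y # cs))" using less.prems(2) by (auto simp: xs)
    then show ?thesis
    proof
      assume "odd (length (y # bs))"
      from less.hyps[OF _ 1 this] show ?thesis by (auto simp: xs)
    next
      assume "odd (length (as @ y # cs))"
      from less.hyps[OF _ 2 this] show ?thesis by (auto simp: xs)
    qed
  qed (use less.prems in blast)
qed

text \<open>Without odd closed walks, the parity of a walk from a fixed vertex of each component is
  a proper 2-colouring, and the larger colour class is independent. A loop is an odd cycle of length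
  1.\<close>

lemma odd_cycle_or_independent_half:
  assumes fin: "finite I" and sym: "\<And>i j. G i j \<Longrightarrow> G j i"
  shows "(\<exists>is. closed_walk G is \<and> odd (length is) \<and> distinct is \<and> set is \<subseteq> I) \<or>
         (\<exists>J\<subseteq>I. card I \<le> 2 * card J \<and> (\<forall>i\<in>J. \<forall>j\<in>J. \<not> G i j))"
proof (rule disjCI)
  assume no: "\<not> (\<exists>J\<subseteq>I. card I \<le> 2 * card J \<and> (\<forall>i\<in>J. \<forall>j\<in>J. \<not> G i j))"
  define E where "E = {(i, j). i \<in> I \<and> j \<in> I \<and> G i j}"
  have symE: "sym E" using sym by (auto simp: E_def intro: symI)
  have symn: "(j, i) \<in> E ^^ n" if "(i, j) \<in> E ^^ n" for i j n
    using that
  proof (induction n arbitrary: j)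
    case (Suc n)
    then obtain m where "(i, m) \<in> E ^^ n" "(m, j) \<in> E" by auto
    then have "(m, i) \<in> E ^^ n" "(j, m) \<in> E" using Suc.IH symE by (auto dest: symD)
    then show ?case by (rule relpow_Suc_I2[rotated])
  qed simp
  \<comment> \<open>Adjacent vertices are reached from the same vertices, so \<open>SOME\<close> is
    applied to equal predicates and gives one root per component.\<close>
  define root where "root v = (SOME u. (u, v) \<in> E\<^sup>*)" for v
  have root: "(root v, v) \<in> E\<^sup>*" for v unfolding root_def by (rule someI[of _ v]) simp
  have root_eq: "root u = root v" if "(u, v) \<in> E" for u v
  proof -
    have "(v, u) \<in> E" using that symE by (auto dest: symD)
    then have "(\<lambda>x. (x, u) \<in> E\<^sup>*) = (\<lambda>x. (x, v) \<in> E\<^sup>*)"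
      using that by (auto intro: rtrancl_into_rtrancl)
    then show ?thesis by (simp add: root_def)
  qed
  define c where "c v \<longleftrightarrow> (\<exists>n. even n \<and> (root v, v) \<in> E ^^ n)" for v
  have "\<exists>n v. odd n \<and> (v, v) \<in> E ^^ n"
  proof (rule ccontr)
    assume none: "\<nexists>n v. odd n \<and> (v, v) \<in> E ^^ n"
    have proper: "c u \<noteq> c v" if uv: "(u, v) \<in> E" for u v
    proof
      assume eq: "c u = c v"
      obtain m n where m: "(root u, u) \<in> E ^^ m" "even m = c u" and n: "(root v, v) \<in> E ^^ n" "even n = c v"
        using root[of u] root[of v] unfolding c_def rtrancl_power by metis
      have "(root u, v) \<in> E ^^ Suc m" using m(1) uv by auto
      then have "(root u, root v) \<in> E ^^ (Suc m + n)"
        using symn[OF n(1)] unfolding relpow_add by (rule relcompI)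
      moreover have "odd (Suc m + n)" using m(2) n(2) eq by auto
      ultimately show False using none root_eq[OF uv] by metis
    qed
    have ind: "\<forall>i\<in>{v \<in> I. c v = t}. \<forall>j\<in>{v \<in> I. c v = t}. \<not> G i j" for t
      using proper by (auto simp: E_def)
    have "card I = card ({v \<in> I. c v = True} \<union> {v \<in> I. c v = False})"
      by (rule arg_cong[where f = card]) auto
    also have "\<dots> \<le> card {v \<in> I. c v = True} + card {v \<in> I. c v = False}" by (rule card_Un_le)
    finally have "card I \<le> 2 * card {v \<in> I. c v = True} \<or> card I \<le> 2 * card {v \<in> I. c v = False}"
      by linarith
    then obtain t where t: "card I \<le> 2 * card {v \<in> I. c v = t}" by blast
    have "{v \<in> I. c v = t} \<subseteq> I" by blast
    then show False using no t ind[of t] by meson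
  qed
  then obtain n v where n: "odd n" "(v, v) \<in> E ^^ n" by blast
  then obtain f where f: "f 0 = v" "f n = v" "\<And>i. i < n \<Longrightarrow> (f i, f (Suc i)) \<in> E"
    by (auto simp: relpow_fun_conv)
  obtain m where m: "n = Suc m" using n(1) by (cases n) auto
  let ?xs = "map f [0..<n]"
  have "closed_walk G ?xs"
    unfolding closed_walk_def
  proof (intro conjI)
    show "successively G ?xs"
      unfolding successively_conv_nth using f(3) by (auto simp: E_def)
    show "G (last ?xs) (hd ?xs)"
      using f(1,2) f(3)[of m] by (auto simp: m E_def hd_map simp del: upt_Suc) (simp add: last_map)
  qed (use m in auto)
  moreover have "set ?xs \<subseteq> I" using f(3) by (auto simp: E_def)
  ultimately show "\<exists>is. closed_walk G is \<and> odd (length is) \<and> distinct is \<and> set is \<subseteq> I"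
    using odd_closed_walk_imp_odd_cycle[of G ?xs] n(1)
    by (metis (no_types, lifting) length_map length_upt minus_nat.diff_0 order_trans)
qed

section \<open>Eliminating colours\<close>

definition no_edge :: "('a \<Rightarrow> 'a \<Rightarrow> bool) \<Rightarrow> 'a set \<Rightarrow> 'a set \<Rightarrow> bool" where
  "no_edge R A B \<longleftrightarrow> (\<forall>x\<in>A. \<forall>y\<in>B. \<not> R x y)"

definition cyclic :: "('a \<Rightarrow> 'a \<Rightarrow> bool) \<Rightarrow> nat \<Rightarrow> bool" where
  "cyclic R l \<longleftrightarrow> (\<exists>xs. length xs = l \<and> distinct xs \<and> closed_walk R xs)"

lemma no_edge_mono: "no_edge R A B \<Longrightarrow> A' \<subseteq> A \<Longrightarrow> B' \<subseteq> B \<Longrightarrow> no_edge R A' B'"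
  by (auto simp: no_edge_def)

lemma no_edge_sym: "symp R \<Longrightarrow> no_edge R A B \<Longrightarrow> no_edge R B A"
  by (auto simp: no_edge_def dest: sympD)

lemma joined_sym: "symp R \<Longrightarrow> joined R A k B l \<Longrightarrow> joined R B l A k"
  unfolding joined_def by (meson sympD)

lemma not_joined_imp_no_edge:
  assumes "\<not> joined R A k B l"
  obtains X Y where "X \<subseteq> A" "Y \<subseteq> B" "card X = k" "card Y = l" "no_edge R X Y"
proof -
  obtain X Y where XY: "X \<subseteq> A" "Y \<subseteq> B" "k \<le> card X" "l \<le> card Y" "no_edge R X Y"
    using assms by (auto simp: joined_def no_edge_def)
  obtain X' where X': "X' \<subseteq> X" "card X' = k" using XY(3) by (rule obtain_subset_with_card_n)
  obtain Y' where Y': "Y' \<subseteq> Y" "card Y' = l" using XY(4) by (rule obtain_subset_with_card_n)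
  show ?thesis
    by (rule that[of X' Y']) (use XY X' Y' in \<open>auto intro: no_edge_mono\<close>)
qed

lemma closed_walk_mono:
  assumes "closed_walk G xs" "\<And>x y. x \<in> set xs \<Longrightarrow> y \<in> set xs \<Longrightarrow> G x y \<Longrightarrow> H x y"
  shows "closed_walk H xs"
  using assms unfolding closed_walk_def by (auto intro: successively_mono)

text \<open>Serves to bound degrees when clusters are split. Once the walk is rotated to begin at
  \<open>x\<close>, the neighbours of \<open>x\<close> are the two ends of the remaining list, which
  differ because at least two vertices remain.\<close>

lemma closed_walk_two_neighbours:
  assumes "closed_walk G xs" "distinct xs" "3 \<le> length xs" "x \<in> set xs" and sym: "symp G"
  obtains y z where "y \<noteq> z" "G x y" "G x z"
proof -
  obtain as bs where xs: "xs = as @ x # bs" using assms(4) by (meson split_list)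
  have cw: "closed_walk G (x # bs @ as)"
    using assms(1) unfolding xs closed_walk_def
    by (cases bs; cases as) (auto simp: successively_append_iff successively_Cons hd_append split: if_splits)
  obtain y ms z where yz: "bs @ as = y # ms @ [z]"
    using assms(3) unfolding xs
    by (cases "bs @ as"; cases "tl (bs @ as)" rule: rev_cases) (auto simp del: append_is_Nil_conv dest: arg_cong[where f = length])
  have "distinct (bs @ as)" using assms(2) by (auto simp: xs)
  then have "y \<noteq> z" by (auto simp: yz)
  moreover have "G x y" "G x z" using cw sym unfolding yz closed_walk_def by (auto dest: sympD)
  ultimately show ?thesis by (rule that)
qed

text \<open>Two joined clusters form a closed walk of length 2, which would yield the forbidden
  cycle of even length.\<close>

lemma split_pair:
  assumes sym: "symp R" and fin: "finite A" "finite B" and disj: "A \<inter> B = {}"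
    and size: "25 * k \<le> card A" "25 * k \<le> card B"
    and l: "even l" "2 * h + 5 \<le> l" "l \<le> n" "n \<le> k" "2 * k \<le> 3 ^ h" and no: "\<not> cyclic R l"
  obtains X Y where "X \<subseteq> A" "Y \<subseteq> B" "card X = k" "card Y = k" "no_edge R X Y"
proof (rule not_joined_imp_no_edge)
  show "\<not> joined R A k B k"
  proof
    assume J: "joined R A k B k"
    have J': "joined R B k A k" using J sym joined_sym by blast
    have "cyclic R l"
      unfolding cyclic_def
    proof (rule cluster_cycle[of R "[True, False]" "\<lambda>b. if b then A else B" "\<lambda>_. k" n h l])
      show "closed_walk (\<lambda>i j. joined R (if i then A else B) k (if j then A else B) k) [True, False]"
        using J J' by (simp add: closed_walk_def)
    qed (use sym fin disj size l in \<open>auto dest: sympD\<close>)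
    then show False using no by simp
  qed
qed (rule that)

text \<open>\<open>52 = 25 + 25 + 2\<close>. For odd \<open>l\<close> the three parts would form a
  triangle of joined clusters; the long path uses only \<open>A\<close> and \<open>B\<close>, so the
  third part \<open>C\<close> can be as small as \<open>2 * k\<close>.\<close>

lemma split_set:
  assumes sym: "symp R" and fin: "finite V" and size: "52 * k \<le> card V"
    and l: "2 * h + 6 \<le> l" "l \<le> n" "n \<le> k" "2 * k \<le> 3 ^ h" and no: "\<not> cyclic R l"
  obtains X Y where "X \<subseteq> V" "Y \<subseteq> V" "X \<inter> Y = {}" "card X = k" "card Y = k" "no_edge R X Y"
proof -
  note found = that
  obtain A where A: "A \<subseteq> V" "card A = 25 * k" "finite A"
    using obtain_subset_with_card_n[of "25 * k" V] size by auto
  have "card (V - A) = card V - 25 * k" using A by (simp add: card_Diff_subset)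
  then have "25 * k \<le> card (V - A)" using size by simp
  then obtain B where B: "B \<subseteq> V - A" "card B = 25 * k" "finite B"
    using fin by (meson finite_Diff finite_subset obtain_subset_with_card_n)
  define C where "C = V - A - B"
  have "card C = card (V - A) - 25 * k" unfolding C_def using B by (simp add: card_Diff_subset)
  then have C: "2 * k \<le> card C" "finite C" using \<open>card (V - A) = card V - 25 * k\<close> size fin
    by (auto simp: C_def)
  have pair: "thesis" if S: "S \<subseteq> V" "T \<subseteq> V" "S \<inter> T = {}" "\<not> joined R S k T k" for S T
  proof -
    obtain X Y where XY: "X \<subseteq> S" "Y \<subseteq> T" "card X = k" "card Y = k" "no_edge R X Y"
      using S(4) by (rule not_joined_imp_no_edge)
    have "X \<subseteq> V" "Y \<subseteq> V" "X \<inter> Y = {}" using XY S by auto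
    from found[OF this XY(3-5)] show thesis .
  qed
  show thesis
  proof (cases "even l")
    case True
    obtain X Y where XY: "X \<subseteq> A" "Y \<subseteq> B" "card X = k" "card Y = k" "no_edge R X Y"
      by (rule split_pair[of R A B k l h n]) (use sym A B l no True in auto)
    show thesis by (rule that[of X Y]) (use XY A B in auto)
  next
    case False
    have "\<not> (joined R A k C k \<and> joined R C k B k \<and> joined R B k A k)"
    proof
      assume J: "joined R A k C k \<and> joined R C k B k \<and> joined R B k A k"
      define X where "X i = (if i = 0 then A else if i = 1 then C else B)" for i :: nat
      have "cyclic R l"
        unfolding cyclic_def
      proof (rule cluster_cycle[of R "[0::nat, 1, 2]" X "\<lambda>_. k" n h l])
        show "closed_walk (\<lambda>i j. joined R (X i) k (X j) k) [0::nat, 1, 2]"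
          using J by (simp add: closed_walk_def X_def)
        show "X i \<inter> X j = {}" if "i \<in> set [0, 1, 2]" "j \<in> set [0, 1, 2]" "i \<noteq> j" for i j
          using that B(1) C_def by (auto simp: X_def)
        show "2 * k \<le> card (X i)" for i using A B C by (auto simp: X_def)
      qed (use sym A B C l False in \<open>auto simp: X_def dest: sympD\<close>)
      then show False using no by simp
    qed
    then consider "\<not> joined R A k C k" | "\<not> joined R C k B k" | "\<not> joined R B k A k" by blast
    then show thesis
      by cases (erule pair[rotated 3]; use A B C_def in auto)+
  qed
qed

text \<open>\<open>R\<close> has no cycle of length \<open>l\<close> anywhere, so each half can be
  split again by the same relation. Edges between the two halves are already absent, and this is
  inherited by the pieces.\<close>

lemma split_set_iterated:
  assumes sym: "symp R" and no: "\<not> cyclic R l"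
    and l: "2 * h + 6 \<le> l" "l \<le> n" "n \<le> k"
    and "finite V" "52 ^ d * k \<le> card V" "2 * 52 ^ d * k \<le> 3 ^ h"
  shows "\<exists>Z :: nat \<Rightarrow> 'a set. (\<forall>i<2 ^ d. Z i \<subseteq> V \<and> card (Z i) = k) \<and>
           (\<forall>i<2 ^ d. \<forall>j<2 ^ d. i \<noteq> j \<longrightarrow> Z i \<inter> Z j = {} \<and> no_edge R (Z i) (Z j))"
  using assms(6-8)
proof (induction d arbitrary: V)
  case 0
  then obtain X where "X \<subseteq> V" "card X = k" using obtain_subset_with_card_n[of k V] by auto
  then show ?case by (intro exI[of _ "\<lambda>_. X"]) simp
next
  case (Suc d)
  have kd: "n \<le> 52 ^ d * k" using l(3) by (rule order_trans) simp
  obtain X Y where XY: "X \<subseteq> V" "Y \<subseteq> V" "X \<inter> Y = {}" "card X = 52 ^ d * k" "card Y = 52 ^ d * k"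
      "no_edge R X Y"
    by (rule split_set[of R V "52 ^ d * k" h l n]) (use sym no l kd Suc.prems in auto)
  have fin: "finite X" "finite Y" using XY(1,2) Suc.prems(1) by (auto intro: finite_subset)
  obtain F :: "nat \<Rightarrow> 'a set" where F: "\<forall>i<2 ^ d. F i \<subseteq> X \<and> card (F i) = k"
      "\<forall>i<2 ^ d. \<forall>j<2 ^ d. i \<noteq> j \<longrightarrow> F i \<inter> F j = {} \<and> no_edge R (F i) (F j)"
    using Suc.IH[of X] fin XY(4) Suc.prems(3) by auto
  obtain G :: "nat \<Rightarrow> 'a set" where G: "\<forall>i<2 ^ d. G i \<subseteq> Y \<and> card (G i) = k"
      "\<forall>i<2 ^ d. \<forall>j<2 ^ d. i \<noteq> j \<longrightarrow> G i \<inter> G j = {} \<and> no_edge R (G i) (G j)"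
    using Suc.IH[of Y] fin XY(5) Suc.prems(3) by auto
  have cross: "F i \<inter> G j = {} \<and> no_edge R (F i) (G j) \<and> G j \<inter> F i = {} \<and> no_edge R (G j) (F i)"
    if "i < 2 ^ d" "j < 2 ^ d" for i j
  proof -
    have sub: "F i \<subseteq> X" "G j \<subseteq> Y" using F(1) G(1) that by auto
    have "no_edge R (F i) (G j)" using XY(6) sub by (rule no_edge_mono)
    moreover from this have "no_edge R (G j) (F i)" by (rule no_edge_sym[OF sym])
    ultimately show ?thesis using sub XY(3) by blast
  qed
  define Z where "Z i = (if i < 2 ^ d then F i else G (i - 2 ^ d))" for i :: nat
  have "Z i \<subseteq> V \<and> card (Z i) = k" if "i < 2 ^ Suc d" for i
  proof (cases "i < 2 ^ d")
    case True
    then have "F i \<subseteq> X \<and> card (F i) = k" using F(1) by blast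
    then show ?thesis using True XY(1) by (auto simp: Z_def)
  next
    case False
    then have "i - 2 ^ d < 2 ^ d" using that by simp
    then have "G (i - 2 ^ d) \<subseteq> Y \<and> card (G (i - 2 ^ d)) = k" using G(1) by blast
    then show ?thesis using False XY(2) by (auto simp: Z_def)
  qed
  moreover have "Z i \<inter> Z j = {} \<and> no_edge R (Z i) (Z j)"
    if "i < 2 ^ Suc d" "j < 2 ^ Suc d" "i \<noteq> j" for i j
    using that F(2)[rule_format, of i j] G(2)[rule_format, of "i - 2 ^ d" "j - 2 ^ d"] cross[of i "j - 2 ^ d"] cross[of j "i - 2 ^ d"]
    by (cases "i < 2 ^ d"; cases "j < 2 ^ d") (auto simp: Z_def)
  ultimately show ?case by blast
qed

text \<open>Record a set \<open>\<Phi>\<close> of pairs already made edge-free, each such pair costing both members a factor 25.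
  While the remaining pairs contain an odd cycle, one of its pairs can be added to \<open>\<Phi>\<close>; both members
  then had two neighbours outside \<open>\<Phi>\<close>, so no cluster pays more than \<open>2 * q - 1\<close> times.\<close>

lemma split_clusters:
  fixes V :: "'i \<Rightarrow> 'a set"
  assumes sym: "symp R" and no: "\<not> cyclic R l"
    and finI: "finite I" and cardI: "card I = 2 * q + 1" and q: "1 \<le> q"
    and fin: "\<And>i. i \<in> I \<Longrightarrow> finite (V i)"
    and size: "\<And>i. i \<in> I \<Longrightarrow> 25 ^ (2 * q - 1) * k \<le> card (V i)"
    and disj: "\<And>i j. i \<in> I \<Longrightarrow> j \<in> I \<Longrightarrow> i \<noteq> j \<Longrightarrow> V i \<inter> V j = {}"
    and l: "odd l" "2 * h + 3 + card I \<le> l" "l \<le> n" "n \<le> k" "2 * 25 ^ (2 * q - 1) * k \<le> 3 ^ h"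
  shows "\<exists>J Y. J \<subseteq> I \<and> card J = q + 1 \<and> (\<forall>i\<in>J. Y i \<subseteq> V i \<and> card (Y i) = k) \<and>
           (\<forall>i\<in>J. \<forall>j\<in>J. i \<noteq> j \<longrightarrow> no_edge R (Y i) (Y j))"
proof -
  define deg :: "('i \<times> 'i) set \<Rightarrow> 'i \<Rightarrow> nat" where "deg \<Phi> i = card (\<Phi> `` {i})" for \<Phi> i
  define state where "state = (\<lambda>(\<Phi>, Y). \<Phi> \<subseteq> I \<times> I \<and> sym \<Phi> \<and> irrefl \<Phi> \<and>
     (\<forall>i\<in>I. deg \<Phi> i \<le> 2 * q - 1 \<and> Y i \<subseteq> V i \<and> card (Y i) = 25 ^ (2 * q - 1 - deg \<Phi> i) * k) \<and>
     (\<forall>(i, j)\<in>\<Phi>. no_edge R (Y i) (Y j)))"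
  obtain Y0 where Y0: "\<And>i. i \<in> I \<Longrightarrow> Y0 i \<subseteq> V i \<and> card (Y0 i) = 25 ^ (2 * q - 1) * k"
  proof -
    have "\<exists>Y. Y \<subseteq> V i \<and> card Y = 25 ^ (2 * q - 1) * k" if "i \<in> I" for i
      using obtain_subset_with_card_n[OF size[OF that]] by metis
    then show thesis using that by metis
  qed
  have s0: "state ({}, Y0)" using Y0 by (auto simp: state_def deg_def sym_def irrefl_def)
  have bnd: "\<forall>s. state s \<longrightarrow> card (fst s) < Suc (card (I \<times> I))"
  proof (intro allI impI)
    fix s assume "state s"
    then have "fst s \<subseteq> I \<times> I" by (auto simp: state_def)
    then show "card (fst s) < Suc (card (I \<times> I))"
      using finI by (meson card_mono finite_SigmaI le_imp_less_Suc)
  qed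
  obtain s where s: "state s" and smax: "\<And>s'. state s' \<Longrightarrow> card (fst s') \<le> card (fst s)"
    using ex_has_greatest_nat[of state, OF s0 bnd] by blast
  obtain \<Phi> Y where sY: "s = (\<Phi>, Y)" by force
  have st: "state (\<Phi>, Y)" and mx: "\<And>s'. state s' \<Longrightarrow> card (fst s') \<le> card \<Phi>"
    using s smax by (auto simp: sY)
  have \<Phi>I: "\<Phi> \<subseteq> I \<times> I" and sym\<Phi>: "sym \<Phi>" and irr: "irrefl \<Phi>"
    and deg: "\<And>i. i \<in> I \<Longrightarrow> deg \<Phi> i \<le> 2 * q - 1"
    and YV: "\<And>i. i \<in> I \<Longrightarrow> Y i \<subseteq> V i"
    and cY: "\<And>i. i \<in> I \<Longrightarrow> card (Y i) = 25 ^ (2 * q - 1 - deg \<Phi> i) * k"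
    and free: "\<And>i j. (i, j) \<in> \<Phi> \<Longrightarrow> no_edge R (Y i) (Y j)"
    using st by (auto simp: state_def)
  have fin\<Phi>: "finite \<Phi>" using \<Phi>I finI finite_subset by blast
  define G where "G i j \<longleftrightarrow> i \<in> I \<and> j \<in> I \<and> i \<noteq> j \<and> (i, j) \<notin> \<Phi>" for i j
  have symG: "symp G" using sym\<Phi> by (auto simp: symp_def G_def dest: symD)
  have symG': "G j i" if "G i j" for i j using symG that by (rule sympD)
  from odd_cycle_or_independent_half[OF finI symG']
  show ?thesis
  proof
    assume "\<exists>J\<subseteq>I. card I \<le> 2 * card J \<and> (\<forall>i\<in>J. \<forall>j\<in>J. \<not> G i j)"
    then obtain J0 where J0: "J0 \<subseteq> I" "card I \<le> 2 * card J0" "\<forall>i\<in>J0. \<forall>j\<in>J0. \<not> G i j" by blast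
    then have "q + 1 \<le> card J0" using cardI by simp
    then obtain J where J: "J \<subseteq> J0" "card J = q + 1" by (rule obtain_subset_with_card_n)
    have "\<exists>X. X \<subseteq> Y i \<and> card X = k" if "i \<in> J" for i
    proof -
      have "k \<le> card (Y i)" using cY[of i] that J J0 by auto
      then show ?thesis by (metis obtain_subset_with_card_n)
    qed
    then obtain X where X: "\<And>i. i \<in> J \<Longrightarrow> X i \<subseteq> Y i \<and> card (X i) = k" by metis
    have "no_edge R (X i) (X j)" if "i \<in> J" "j \<in> J" "i \<noteq> j" for i j
    proof -
      have "i \<in> J0" "j \<in> J0" using that J(1) by auto
      then have "(i, j) \<in> \<Phi>" using that(3) J0(1,3) unfolding G_def by blast
      then show ?thesis using free X that by (blast intro: no_edge_mono)
    qed
    then show ?thesis using J J0 X YV by (intro exI[of _ J] exI[of _ X]) blast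
  next
    assume "\<exists>is. closed_walk G is \<and> odd (length is) \<and> distinct is \<and> set is \<subseteq> I"
    then obtain "is" where cyc: "closed_walk G is" "odd (length is)" "distinct is" "set is \<subseteq> I" by blast
    have len: "3 \<le> length is"
    proof (rule ccontr)
      assume "\<not> ?thesis"
      then have "length is = 1" using cyc(2) by (cases "length is" rule: nat.exhaust) (auto simp: numeral_3_eq_3 elim!: less_SucE)
      then obtain i where "is = [i]" by (cases "is") auto
      then show False using cyc(1) by (simp add: closed_walk_def G_def)
    qed
    \<comment> \<open>Neither \<open>i\<close> nor its two neighbours on the cycle are partners of
      \<open>i\<close> in \<open>\<Phi>\<close>, which leaves at most \<open>2 * q + 1 - 3\<close>
      partners. So \<open>i\<close> can afford one more split within the budget
      \<open>2 * q - 1\<close>.\<close>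
    have deg2: "deg \<Phi> i \<le> 2 * q - 2" if i: "i \<in> set is" for i
    proof -
      obtain y z where yz: "y \<noteq> z" "G i y" "G i z"
        using closed_walk_two_neighbours[OF cyc(1,3) len i symG] by blast
      have "\<Phi> `` {i} \<subseteq> I - {i, y, z}" using \<Phi>I irr yz by (auto simp: G_def irrefl_def)
      then have "deg \<Phi> i \<le> card (I - {i, y, z})"
        unfolding deg_def using finI by (intro card_mono) auto
      also have "\<dots> = card I - card {i, y, z}"
        using yz by (intro card_Diff_subset) (auto simp: G_def)
      also have "card {i, y, z} = 3" using yz by (auto simp: G_def)
      finally show ?thesis using cardI by simp
    qed
    \<comment> \<open>The size after one more split. It depends on \<open>i\<close> because the
      clusters on the cycle may have been split a different number of times.\<close>
    define \<kappa> where "\<kappa> i = 25 ^ (2 * q - 2 - deg \<Phi> i) * k" for i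
    have cY': "card (Y i) = 25 * \<kappa> i" if "i \<in> set is" for i
    proof -
      have "2 * q - 1 - deg \<Phi> i = Suc (2 * q - 2 - deg \<Phi> i)" using deg2[OF that] q by simp
      then show ?thesis using cY[of i] that cyc(4) by (auto simp: \<kappa>_def)
    qed
    have \<kappa>n: "n \<le> \<kappa> i" for i unfolding \<kappa>_def using l(4) by (rule order_trans) simp
    have \<kappa>h: "2 * \<kappa> i \<le> 3 ^ h" for i
    proof -
      have "(25::nat) ^ (2 * q - 2 - deg \<Phi> i) \<le> 25 ^ (2 * q - 1)" by (rule power_increasing) auto
      then have "2 * \<kappa> i \<le> 2 * 25 ^ (2 * q - 1) * k" by (simp add: \<kappa>_def)
      then show ?thesis using l(5) by simp
    qed
    have "\<not> closed_walk (\<lambda>i j. joined R (Y i) (\<kappa> i) (Y j) (\<kappa> j)) is"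
    proof
      assume J: "closed_walk (\<lambda>i j. joined R (Y i) (\<kappa> i) (Y j) (\<kappa> j)) is"
      have "length is \<le> card I" using cyc(3,4) finI by (metis card_mono distinct_card)
      have "cyclic R l"
        unfolding cyclic_def
      proof (rule cluster_cycle[OF _ cyc(3) _ _ J, of n h l])
        show "Y i \<inter> Y j = {}" if "i \<in> set is" "j \<in> set is" "i \<noteq> j" for i j
          using that cyc(4) YV[of i] YV[of j] disj[of i j] by blast
        show "finite (Y i)" if "i \<in> set is" for i
          using that cyc(4) YV[of i] fin[of i] by (auto intro: finite_subset)
        show "25 * \<kappa> i \<le> card (Y i) \<and> n \<le> \<kappa> i \<and> 2 * \<kappa> i \<le> 3 ^ h" if "i \<in> {hd is, last is}" for i
        proof -
          have "i \<in> set is" using that len by (cases "is") auto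
          then show ?thesis using cY'[of i] \<kappa>n \<kappa>h by simp
        qed
        show "R y x" if "R x y" for x y using sym that by (rule sympD)
      qed (use len cY' cyc(2) l \<open>length is \<le> card I\<close> in auto)
      then show False using no by simp
    qed
    then have "\<exists>i j. i \<in> set is \<and> j \<in> set is \<and> G i j \<and> \<not> joined R (Y i) (\<kappa> i) (Y j) (\<kappa> j)"
      using closed_walk_mono[OF cyc(1), of "\<lambda>i j. joined R (Y i) (\<kappa> i) (Y j) (\<kappa> j)"] by blast
    then obtain i j where ij: "i \<in> set is" "j \<in> set is" "G i j"
      and nj: "\<not> joined R (Y i) (\<kappa> i) (Y j) (\<kappa> j)" by blast
    obtain A B where AB: "A \<subseteq> Y i" "B \<subseteq> Y j" "card A = \<kappa> i" "card B = \<kappa> j" "no_edge R A B"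
      using nj by (rule not_joined_imp_no_edge)
    have ne: "i \<noteq> j" "i \<in> I" "j \<in> I" "(i, j) \<notin> \<Phi>" "(j, i) \<notin> \<Phi>"
      using ij(3) symG'[OF ij(3)] by (auto simp: G_def)
    define \<Phi>' where "\<Phi>' = insert (i, j) (insert (j, i) \<Phi>)"
    define Y' where "Y' = Y(i := A, j := B)"
    have Y'Y: "Y' m \<subseteq> Y m" for m using AB by (auto simp: Y'_def)
    have fin1: "finite (\<Phi> `` {m})" for m using fin\<Phi> by (rule finite_Image)
    have "\<Phi>' `` {i} = insert j (\<Phi> `` {i})" "\<Phi>' `` {j} = insert i (\<Phi> `` {j})"
      and same: "\<And>m. m \<noteq> i \<Longrightarrow> m \<noteq> j \<Longrightarrow> \<Phi>' `` {m} = \<Phi> `` {m}"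
      using ne by (auto simp: \<Phi>'_def)
    then have degs: "deg \<Phi>' i = Suc (deg \<Phi> i)" "deg \<Phi>' j = Suc (deg \<Phi> j)"
      "\<And>m. m \<noteq> i \<Longrightarrow> m \<noteq> j \<Longrightarrow> deg \<Phi>' m = deg \<Phi> m"
      using ne fin1 by (auto simp: deg_def)
    have "deg \<Phi>' m \<le> 2 * q - 1 \<and> Y' m \<subseteq> V m \<and> card (Y' m) = 25 ^ (2 * q - 1 - deg \<Phi>' m) * k"
      if m: "m \<in> I" for m
    proof -
      have eq: "2 * q - 1 - Suc d = 2 * q - 2 - d" for d by simp
      consider "m = i" | "m = j" | "m \<noteq> i" "m \<noteq> j" by blast
      then show ?thesis
      proof cases
        case 1
        then show ?thesis using degs(1) deg2[OF ij(1)] q AB YV[OF m] ne(1) eq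
          by (auto simp: Y'_def \<kappa>_def)
      next
        case 2
        then show ?thesis using degs(2) deg2[OF ij(2)] q AB YV[OF m] eq
          by (auto simp: Y'_def \<kappa>_def)
      next
        case 3
        then show ?thesis using degs(3) deg[OF m] YV[OF m] cY[OF m] by (auto simp: Y'_def)
      qed
    qed
    moreover have "no_edge R (Y' a) (Y' b)" if ab: "(a, b) \<in> \<Phi>'" for a b
    proof -
      consider "(a, b) \<in> \<Phi>" | "a = i" "b = j" | "a = j" "b = i" using ab by (auto simp: \<Phi>'_def)
      then show ?thesis
      proof cases
        case 1
        then show ?thesis using free Y'Y by (blast intro: no_edge_mono)
      next
        case 2
        then show ?thesis using AB(5) ne(1) by (simp add: Y'_def)
      next
        case 3
        then show ?thesis using no_edge_sym[OF sym AB(5)] ne(1) by (simp add: Y'_def)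
      qed
    qed
    moreover have "sym \<Phi>'" using sym\<Phi> by (auto simp: \<Phi>'_def sym_def)
    moreover have "irrefl \<Phi>'" using irr ne(1) by (auto simp: \<Phi>'_def irrefl_def)
    moreover have "\<Phi>' \<subseteq> I \<times> I" using \<Phi>I ne by (auto simp: \<Phi>'_def)
    ultimately have "state (\<Phi>', Y')" by (auto simp: state_def)
    from mx[OF this] have "card \<Phi>' \<le> card \<Phi>" by simp
    then show ?thesis using ne fin\<Phi> by (simp add: \<Phi>'_def)
  qed
qed

section \<open>Eliminating several colours in turn\<close>

lemma split_pair_colours:
  fixes F :: "'c \<Rightarrow> 'a \<Rightarrow> 'a \<Rightarrow> bool" and len :: "'c \<Rightarrow> nat"
  assumes sym: "\<And>c. symp (F c)"
    and "\<And>c. c \<in> set cs \<Longrightarrow> even (len c) \<and> \<not> cyclic (F c) (len c) \<and> 2 * h + 5 \<le> len c \<and> len c \<le> n"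
    and n: "n \<le> k" and "2 * 25 ^ length cs * k \<le> 3 ^ h"
    and "finite A" "finite B" "A \<inter> B = {}" "25 ^ length cs * k \<le> card A" "25 ^ length cs * k \<le> card B"
  shows "\<exists>X Y. X \<subseteq> A \<and> Y \<subseteq> B \<and> card X = k \<and> card Y = k \<and> (\<forall>c\<in>set cs. no_edge (F c) X Y)"
  using assms(2,4-9)
proof (induction cs arbitrary: A B)
  case Nil
  obtain X where "X \<subseteq> A" "card X = k" using Nil.prems(6) obtain_subset_with_card_n[of k A] by auto
  moreover obtain Y where "Y \<subseteq> B" "card Y = k" using Nil.prems(7) obtain_subset_with_card_n[of k B] by auto
  ultimately show ?case by auto
next
  case (Cons c cs)
  let ?k = "25 ^ length cs * k"
  have nk: "n \<le> ?k" using n by (rule order_trans) simp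
  obtain A' B' where AB: "A' \<subseteq> A" "B' \<subseteq> B" "card A' = ?k" "card B' = ?k" "no_edge (F c) A' B'"
    by (rule split_pair[of "F c" A B ?k "len c" h n])
       (use sym Cons.prems(1)[of c] Cons.prems(2-7) nk in auto)
  have "\<exists>X Y. X \<subseteq> A' \<and> Y \<subseteq> B' \<and> card X = k \<and> card Y = k \<and> (\<forall>c\<in>set cs. no_edge (F c) X Y)"
  proof (rule Cons.IH)
    show "finite A'" "finite B'" using AB Cons.prems(3,4) by (auto intro: finite_subset)
    show "A' \<inter> B' = {}" using AB Cons.prems(5) by blast
  qed (use AB Cons.prems(1,2) in auto)
  then obtain X Y where XY: "X \<subseteq> A'" "Y \<subseteq> B'" "card X = k" "card Y = k" "\<forall>c\<in>set cs. no_edge (F c) X Y"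
    by blast
  moreover have "no_edge (F c) X Y" using AB(5) XY(1,2) by (rule no_edge_mono)
  ultimately show ?case using AB(1,2) by (intro exI[of _ X] exI[of _ Y]) auto
qed

text \<open>Exponent of 25 lost when \<open>s\<close> odd colours reduce \<open>2 ^ s + 1\<close> clusters to 2 through
  \<open>2 ^ (s - 1) + 1\<close>, \<open>2 ^ (s - 2) + 1\<close>, \<open>\<dots>\<close> clusters.\<close>

fun odd_cost :: "nat \<Rightarrow> nat" where
  "odd_cost 0 = 0"
| "odd_cost (Suc s) = (2 * 2 ^ s - 1) + odd_cost s"

text \<open>The counts fit together: with \<open>q = 2 ^ length cs\<close>, the colour
  \<open>c\<close> reduces \<open>2 * q + 1\<close> clusters to \<open>q + 1\<close>, as the
  induction hypothesis expects, and two clusters remain when no colour is left. A colour once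
  removed stays absent, because later steps only shrink clusters.\<close>

lemma split_clusters_colours:
  fixes F :: "'c \<Rightarrow> 'a \<Rightarrow> 'a \<Rightarrow> bool" and len :: "'c \<Rightarrow> nat" and V :: "'i \<Rightarrow> 'a set"
  assumes sym: "\<And>c. symp (F c)"
    and "\<And>c. c \<in> set cs \<Longrightarrow> odd (len c) \<and> \<not> cyclic (F c) (len c) \<and> 2 * h + 3 + card I \<le> len c \<and> len c \<le> n"
    and n: "n \<le> k" and "2 * 25 ^ odd_cost (length cs) * k \<le> 3 ^ h"
    and "finite I" "card I = 2 ^ length cs + 1"
    and "\<And>i. i \<in> I \<Longrightarrow> finite (V i) \<and> 25 ^ odd_cost (length cs) * k \<le> card (V i)"
    and "\<And>i j. i \<in> I \<Longrightarrow> j \<in> I \<Longrightarrow> i \<noteq> j \<Longrightarrow> V i \<inter> V j = {}"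
  shows "\<exists>i j X Y. i \<in> I \<and> j \<in> I \<and> i \<noteq> j \<and> X \<subseteq> V i \<and> Y \<subseteq> V j \<and> card X = k \<and> card Y = k \<and>
           (\<forall>c\<in>set cs. no_edge (F c) X Y)"
  using assms(2,4-8)
proof (induction cs arbitrary: I V)
  case Nil
  then have "card I = 2" by simp
  then obtain i j where ij: "i \<noteq> j" "I = {i, j}" by (auto simp: card_2_iff)
  obtain X where "X \<subseteq> V i" "card X = k" using Nil.prems(5)[of i] ij obtain_subset_with_card_n[of k "V i"] by auto
  moreover obtain Y where "Y \<subseteq> V j" "card Y = k" using Nil.prems(5)[of j] ij obtain_subset_with_card_n[of k "V j"] by auto
  ultimately show ?case using ij by auto
next
  case (Cons c cs)
  let ?q = "2 ^ length cs :: nat"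
  let ?k = "25 ^ odd_cost (length cs) * k"
  have nk: "n \<le> ?k" using n by (rule order_trans) simp
  have "odd_cost (length (c # cs)) = (2 * ?q - 1) + odd_cost (length cs)" by simp
  then have pw: "25 ^ odd_cost (length (c # cs)) * k = 25 ^ (2 * ?q - 1) * ?k"
    by (simp only: power_add mult.assoc)
  have "\<exists>J Y. J \<subseteq> I \<and> card J = ?q + 1 \<and> (\<forall>i\<in>J. Y i \<subseteq> V i \<and> card (Y i) = ?k) \<and>
           (\<forall>i\<in>J. \<forall>j\<in>J. i \<noteq> j \<longrightarrow> no_edge (F c) (Y i) (Y j))"
  proof (rule split_clusters[of "F c" "len c" I ?q V ?k h n])
    show "25 ^ (2 * ?q - 1) * ?k \<le> card (V i)" if "i \<in> I" for i
      using Cons.prems(5)[OF that] unfolding pw by blast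
    show "2 * 25 ^ (2 * ?q - 1) * ?k \<le> 3 ^ h"
      using Cons.prems(2) by (simp only: mult.assoc pw)
  qed (use sym Cons.prems(1)[of c] Cons.prems(3-6) nk in auto)
  then obtain J Y where J: "J \<subseteq> I" "card J = ?q + 1" "\<forall>i\<in>J. Y i \<subseteq> V i \<and> card (Y i) = ?k"
      "\<forall>i\<in>J. \<forall>j\<in>J. i \<noteq> j \<longrightarrow> no_edge (F c) (Y i) (Y j)" by blast
  have JI: "card J \<le> card I" using J(1) Cons.prems(3) by (rule card_mono[rotated])
  have "\<exists>i j X Z. i \<in> J \<and> j \<in> J \<and> i \<noteq> j \<and> X \<subseteq> Y i \<and> Z \<subseteq> Y j \<and> card X = k \<and> card Z = k \<and>
           (\<forall>c\<in>set cs. no_edge (F c) X Z)"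
  proof (rule Cons.IH)
    show "odd (len d) \<and> \<not> cyclic (F d) (len d) \<and> 2 * h + 3 + card J \<le> len d \<and> len d \<le> n"
      if "d \<in> set cs" for d
      using Cons.prems(1)[of d] that JI by auto
    have "?k \<le> 25 ^ (2 * ?q - 1) * ?k" by simp
    then show "2 * 25 ^ odd_cost (length cs) * k \<le> 3 ^ h"
      using Cons.prems(2) by (simp only: mult.assoc pw)
    show "finite J" using J(1) Cons.prems(3) finite_subset by blast
    show "finite (Y i) \<and> ?k \<le> card (Y i)" if "i \<in> J" for i
      using that J(1,3) Cons.prems(5)[of i] finite_subset by (metis order_refl subsetD)
    show "Y i \<inter> Y j = {}" if "i \<in> J" "j \<in> J" "i \<noteq> j" for i j
      using that J(1,3) Cons.prems(6)[of i j] by blast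
  qed (use J in auto)
  then obtain i j X Z where XZ: "i \<in> J" "j \<in> J" "i \<noteq> j" "X \<subseteq> Y i" "Z \<subseteq> Y j" "card X = k" "card Z = k"
      "\<forall>c\<in>set cs. no_edge (F c) X Z" by blast
  have "no_edge (F c) X Z" using J(4) XZ(1-5) by (blast intro: no_edge_mono)
  moreover have "X \<subseteq> V i" "Z \<subseteq> V j" using J(3) XZ(1,2,4,5) by blast+
  ultimately show ?case using XZ J(1) by (intro exI[of _ i] exI[of _ j] exI[of _ X] exI[of _ Z]) auto
qed

text \<open>For \<open>p\<close> even and \<open>q\<close> odd colours. The first odd colour splits every set in two, \<open>q\<close> times,
  at a factor 52 each, which already yields the \<open>2 ^ (q - 1) + 1\<close> clusters needed for the others.\<close>

definition vertex_factor :: "nat \<Rightarrow> nat \<Rightarrow> nat" where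
  "vertex_factor p q = (if q = 0 then 2 * 25 ^ p else 52 ^ q * 25 ^ (odd_cost (q - 1) + p))"

text \<open>Odd colours go before even ones: they use up a supply of clusters, whereas an even
  colour needs one pair and leaves one pair. The even colours are therefore left to
  \<open>finish\<close>. The summand \<open>2 ^ t\<close> in \<open>len\<close> pays for the
  clusters that an odd cycle may pass through.\<close>

lemma monochromatic_cycle:
  fixes F :: "nat \<Rightarrow> 'a \<Rightarrow> 'a \<Rightarrow> bool" and len :: "nat \<Rightarrow> nat"
  assumes sym: "\<And>c. symp (F c)" and fin: "finite V"
    and size: "vertex_factor (card {c. c < t \<and> even (len c)}) (card {c. c < t \<and> odd (len c)}) * n \<le> card V"
    and h: "2 * card V \<le> 3 ^ h"
    and len: "\<And>c. c < t \<Longrightarrow> 2 * h + 6 + 2 ^ t \<le> len c \<and> len c \<le> n"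
    and edges: "\<And>X Y. X \<subseteq> V \<Longrightarrow> Y \<subseteq> V \<Longrightarrow> X \<inter> Y = {} \<Longrightarrow> card X = n \<Longrightarrow> card Y = n \<Longrightarrow>
                  \<exists>x\<in>X. \<exists>y\<in>Y. \<exists>c<t. F c x y"
  shows "\<exists>c<t. cyclic (F c) (len c)"
proof (rule ccontr)
  assume "\<not> ?thesis"
  then have no: "\<not> cyclic (F c) (len c)" if "c < t" for c using that by blast
  define es where "es = filter (\<lambda>c. even (len c)) [0..<t]"
  define os where "os = filter (\<lambda>c. odd (len c)) [0..<t]"
  have lens: "length es = card {c. c < t \<and> even (len c)}" "length os = card {c. c < t \<and> odd (len c)}"
  proof -
    have "distinct es" "distinct os" by (auto simp: es_def os_def)
    moreover have "set es = {c. c < t \<and> even (len c)}" "set os = {c. c < t \<and> odd (len c)}"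
      by (auto simp: es_def os_def)
    ultimately show "length es = card {c. c < t \<and> even (len c)}" "length os = card {c. c < t \<and> odd (len c)}"
      by (metis distinct_card)+
  qed
  let ?p = "length es" and ?q = "length os"
  have V: "vertex_factor ?p ?q * n \<le> card V" using size lens by simp
  have finish: False
    if AB: "A \<subseteq> V" "B \<subseteq> V" "A \<inter> B = {}" "card A = 25 ^ ?p * n" "card B = 25 ^ ?p * n"
      "\<And>c. c \<in> set os \<Longrightarrow> no_edge (F c) A B" for A B
  proof -
    have finAB: "finite A" "finite B" using AB(1,2) fin by (auto intro: finite_subset)
    have "card A \<le> card V" using AB(1) fin by (rule card_mono[rotated])
    then have "2 * 25 ^ ?p * n \<le> 3 ^ h" using h AB(4) by simp
    then have "\<exists>X Y. X \<subseteq> A \<and> Y \<subseteq> B \<and> card X = n \<and> card Y = n \<and> (\<forall>c\<in>set es. no_edge (F c) X Y)"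
      by (intro split_pair_colours[where len = len and h = h and n = n])
         (use sym finAB AB no len in \<open>fastforce simp: es_def\<close>)+
    then obtain X Y where XY: "X \<subseteq> A" "Y \<subseteq> B" "card X = n" "card Y = n"
      "\<forall>c\<in>set es. no_edge (F c) X Y" by blast
    have "\<exists>x\<in>X. \<exists>y\<in>Y. \<exists>c<t. F c x y"
      by (rule edges) (use XY AB in auto)
    then obtain x y c where xy: "x \<in> X" "y \<in> Y" "c < t" "F c x y" by blast
    have "c \<in> set es \<or> c \<in> set os" using xy(3) by (auto simp: es_def os_def)
    then show False
    proof
      assume "c \<in> set es"
      then show False using XY(5) xy by (auto simp: no_edge_def)
    next
      assume "c \<in> set os"
      then show False using AB(6)[of c] xy XY(1,2) by (auto simp: no_edge_def)
    qed
  qed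
  show False
  proof (cases os)
    case Nil
    then have V2: "2 * (25 ^ ?p * n) \<le> card V" using V by (simp add: vertex_factor_def)
    then obtain A where A: "A \<subseteq> V" "card A = 25 ^ ?p * n" "finite A"
      using obtain_subset_with_card_n[of "25 ^ ?p * n" V] by auto
    have "card (V - A) = card V - card A" using A by (simp add: card_Diff_subset)
    then have "25 ^ ?p * n \<le> card (V - A)" using V2 A by simp
    then obtain B where B: "B \<subseteq> V - A" "card B = 25 ^ ?p * n"
      using obtain_subset_with_card_n[of "25 ^ ?p * n" "V - A"] by blast
    show False by (rule finish[of A B]) (use A B Nil in auto)
  next
    case (Cons c os')
    let ?s = "length os'"
    have q: "?q = Suc ?s" by (simp add: Cons)
    have ct: "c < t" "odd (len c)" using Cons by (auto simp: os_def filter_eq_Cons_iff dest!: arg_cong[where f = set])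
    have os't: "d < t \<and> odd (len d)" if "d \<in> set os'" for d
    proof -
      have "d \<in> set os" using that Cons by simp
      then show ?thesis by (simp add: os_def)
    qed
    have "?q \<le> t" unfolding os_def using length_filter_le[of _ "[0..<t]"] by (metis diff_zero length_upt)
    then have "(2::nat) ^ ?q \<le> 2 ^ t" by (rule power_increasing) simp
    moreover have "(1::nat) \<le> 2 ^ ?s" "(2::nat) ^ ?q = 2 * 2 ^ ?s" by (auto simp: q)
    ultimately have two: "(2::nat) ^ ?s + 1 \<le> 2 ^ ?q" "(2::nat) ^ ?s + 1 \<le> 2 ^ t" by linarith+
    let ?K = "25 ^ ?p * n"
    let ?L = "25 ^ odd_cost ?s * ?K"
    have VL: "52 ^ ?q * ?L \<le> card V"
      using V q by (simp add: vertex_factor_def power_add mult.assoc)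
    have nK: "n \<le> ?K" by simp
    have KL: "?K \<le> ?L" by simp
    have hL: "2 * ?L \<le> 3 ^ h"
    proof -
      have "?L \<le> 52 ^ ?q * ?L" by simp
      then show ?thesis using VL h by linarith
    qed
    have "\<exists>Z :: nat \<Rightarrow> 'a set. (\<forall>i<2 ^ ?q. Z i \<subseteq> V \<and> card (Z i) = ?L) \<and>
           (\<forall>i<2 ^ ?q. \<forall>j<2 ^ ?q. i \<noteq> j \<longrightarrow> Z i \<inter> Z j = {} \<and> no_edge (F c) (Z i) (Z j))"
    proof (rule split_set_iterated[of "F c" "len c" h n ?L V ?q])
      show "2 * h + 6 \<le> len c" "len c \<le> n" using len[OF ct(1)] by auto
      show "n \<le> ?L" using nK KL by (rule order_trans)
      show "2 * 52 ^ ?q * ?L \<le> 3 ^ h" using VL h by (simp only: mult.assoc)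
    qed (use sym no ct fin VL in auto)
    then obtain Z :: "nat \<Rightarrow> 'a set" where Z: "\<forall>i<2 ^ ?q. Z i \<subseteq> V \<and> card (Z i) = ?L"
      "\<forall>i<2 ^ ?q. \<forall>j<2 ^ ?q. i \<noteq> j \<longrightarrow> Z i \<inter> Z j = {} \<and> no_edge (F c) (Z i) (Z j)" by blast
    \<comment> \<open>Of the \<open>2 ^ Suc s\<close> sets produced by the first odd colour, where
      \<open>s\<close> is the number of other odd colours, only \<open>2 ^ s + 1\<close> are
      used.\<close>
    let ?I = "{..<(2::nat) ^ ?s + 1}"
    have Ilt: "i < 2 ^ ?q" if "i \<in> ?I" for i using that two(1) by simp
    have "\<exists>i j X Y. i \<in> ?I \<and> j \<in> ?I \<and> i \<noteq> j \<and> X \<subseteq> Z i \<and> Y \<subseteq> Z j \<and> card X = ?K \<and> card Y = ?K \<and>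
           (\<forall>c\<in>set os'. no_edge (F c) X Y)"
    proof (rule split_clusters_colours[where len = len and h = h and n = n])
      show "odd (len d) \<and> \<not> cyclic (F d) (len d) \<and> 2 * h + 3 + card ?I \<le> len d \<and> len d \<le> n"
        if "d \<in> set os'" for d
      proof -
        have "d < t" "odd (len d)" using os't[OF that] by auto
        then show ?thesis using no[of d] len[of d] two(2) by simp
      qed
      show "2 * 25 ^ odd_cost ?s * ?K \<le> 3 ^ h" using hL by (simp only: mult.assoc)
      show "finite (Z i) \<and> ?L \<le> card (Z i)" if "i \<in> ?I" for i
      proof -
        have "Z i \<subseteq> V" "card (Z i) = ?L" using Z(1) Ilt[OF that] by auto
        then show ?thesis using fin by (auto intro: finite_subset)
      qed
      show "Z i \<inter> Z j = {}" if "i \<in> ?I" "j \<in> ?I" "i \<noteq> j" for i j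
        using Z(2) Ilt[OF that(1)] Ilt[OF that(2)] that(3) by blast
    qed (use sym nK in auto)
    then obtain i j A B where AB: "i \<in> ?I" "j \<in> ?I" "i \<noteq> j" "A \<subseteq> Z i" "B \<subseteq> Z j"
      "card A = ?K" "card B = ?K" "\<forall>c\<in>set os'. no_edge (F c) A B" by blast
    have Zij: "Z i \<subseteq> V" "Z j \<subseteq> V" "Z i \<inter> Z j = {}" "no_edge (F c) (Z i) (Z j)"
      using Z Ilt[OF AB(1)] Ilt[OF AB(2)] AB(3) by blast+
    show False
    proof (rule finish[of A B])
      show "no_edge (F d) A B" if "d \<in> set os" for d
      proof (cases "d = c")
        case True
        then show ?thesis using no_edge_mono[OF Zij(4) AB(4,5)] by simp
      next
        case False
        then have "d \<in> set os'" using that Cons by simp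
        then show ?thesis using AB(8) by blast
      qed
    qed (use AB Zij in blast)+
  qed
qed

section \<open>A sparse graph without bipartite holes\<close>

text \<open>By double counting, some element of \<open>K\<close> lies in at least a fraction
  \<open>s / card K\<close> of the sets \<open>H p\<close> not yet hit. Choosing it multiplies the
  number of missed sets by at most \<open>1 - s / card K\<close>; this is a deterministic form of
  choosing \<open>m\<close> random elements.\<close>

lemma greedy_hitting_set:
  fixes H :: "'p \<Rightarrow> 'e set" and s :: nat
  assumes finP: "finite P" and finK: "finite K" and K: "s \<le> card K" "0 < card K"
    and H: "\<And>p. p \<in> P \<Longrightarrow> H p \<subseteq> K \<and> s \<le> card (H p)"
  shows "\<exists>E\<subseteq>K. card E \<le> m \<and> real (card {p \<in> P. E \<inter> H p = {}}) \<le> card P * (1 - s / card K) ^ m"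
proof (induction m)
  case 0
  show ?case by (intro exI[of _ "{}"]) simp
next
  case (Suc m)
  then obtain E where E: "E \<subseteq> K" "card E \<le> m"
    and le: "real (card {p \<in> P. E \<inter> H p = {}}) \<le> card P * (1 - s / card K) ^ m" by blast
  define Q where "Q = {p \<in> P. E \<inter> H p = {}}"
  have finQ: "finite Q" using finP by (simp add: Q_def)
  have "\<exists>e\<in>K. s * card Q \<le> card K * card {p \<in> Q. e \<in> H p}"
  proof (rule ccontr)
    assume "\<not> ?thesis"
    then have lt: "card K * card {p \<in> Q. e \<in> H p} < s * card Q" if "e \<in> K" for e
      using that by (simp add: not_le)
    have ne: "K \<noteq> {}" using K by auto
    have "card K * (\<Sum>e\<in>K. card {p \<in> Q. e \<in> H p}) = (\<Sum>e\<in>K. card K * card {p \<in> Q. e \<in> H p})"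
      by (simp add: sum_distrib_left)
    also have "\<dots> < (\<Sum>e\<in>K. s * card Q)" using lt finK ne by (intro sum_strict_mono) auto
    also have "\<dots> = card K * (s * card Q)" by simp
    finally have "(\<Sum>e\<in>K. card {p \<in> Q. e \<in> H p}) < s * card Q" by simp
    moreover have "(\<Sum>e\<in>K. card {p \<in> Q. e \<in> H p}) = (\<Sum>e\<in>K. \<Sum>p\<in>Q. if e \<in> H p then 1 else 0)"
      using finQ by (simp add: sum.If_cases Int_def)
    moreover have "\<dots> = (\<Sum>p\<in>Q. \<Sum>e\<in>K. if e \<in> H p then 1 else 0)" by (rule sum.swap)
    moreover have "\<dots> = (\<Sum>p\<in>Q. card (H p))"
    proof (rule sum.cong)
      fix p assume "p \<in> Q"
      then have "K \<inter> H p = H p" using H[of p] by (auto simp: Q_def)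
      then show "(\<Sum>e\<in>K. if e \<in> H p then 1 else 0) = card (H p)"
        using finK by (simp add: sum.If_cases)
    qed simp
    moreover have "(\<Sum>p\<in>Q. s) \<le> (\<Sum>p\<in>Q. card (H p))"
      by (rule sum_mono) (use H in \<open>auto simp: Q_def\<close>)
    ultimately show False by (simp add: mult.commute)
  qed
  then obtain e where e: "e \<in> K" "s * card Q \<le> card K * card {p \<in> Q. e \<in> H p}" by blast
  have "{p \<in> P. insert e E \<inter> H p = {}} = Q - {p \<in> Q. e \<in> H p}" by (auto simp: Q_def)
  then have "card {p \<in> P. insert e E \<inter> H p = {}} = card Q - card {p \<in> Q. e \<in> H p}"
    using finQ by (simp add: card_Diff_subset)
  moreover have "card {p \<in> Q. e \<in> H p} \<le> card Q" using finQ by (auto intro: card_mono)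
  ultimately have eq: "real (card {p \<in> P. insert e E \<inter> H p = {}}) = real (card Q) - real (card {p \<in> Q. e \<in> H p})"
    by simp
  have "real s * real (card Q) \<le> real (card K) * real (card {p \<in> Q. e \<in> H p})"
    using e(2) by (simp flip: of_nat_mult)
  then have "real s / card K * card Q \<le> card {p \<in> Q. e \<in> H p}"
    using K by (simp add: field_simps)
  then have "real (card {p \<in> P. insert e E \<inter> H p = {}}) \<le> (1 - s / card K) * card Q"
    unfolding eq by (simp add: algebra_simps)
  also have "\<dots> \<le> (1 - s / card K) * (card P * (1 - s / card K) ^ m)"
    using le K by (intro mult_left_mono) (auto simp: Q_def)
  finally have "real (card {p \<in> P. insert e E \<inter> H p = {}}) \<le> card P * (1 - s / card K) ^ Suc m"
    by (simp add: algebra_simps)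
  moreover have "card (insert e E) \<le> Suc m" using E(2) by (metis Suc_le_mono card_insert_le_m1 card_insert_if finite_subset[OF E(1) finK] le_SucI)
  ultimately show ?case using E(1) e(1) by (intro exI[of _ "insert e E"]) auto
qed

text \<open>A single term of the exponential series. For \<open>x = n\<close> it bounds
  \<open>n ^ n / fact n\<close> by \<open>exp n\<close>, which is all of Stirling's formula that the
  binomial estimate needs.\<close>

lemma power_div_fact_le_exp:
  fixes x :: real assumes "0 \<le> x"
  shows "x ^ n / fact n \<le> exp x"
proof -
  have "(\<Sum>k\<in>{n}. x ^ k /\<^sub>R fact k) \<le> (\<Sum>k. x ^ k /\<^sub>R fact k)"
    using assms by (intro sum_le_suminf summable_exp_generic) auto
  then show ?thesis by (simp add: exp_def divide_inverse mult.commute)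
qed

text \<open>The number of pairs is at most \<open>(M choose n) ^ 2\<close>, hence at most
  \<open>exp (2 * n * (ln a + 1))\<close>. A pair is joined by \<open>n ^ 2\<close> of fewer than
  \<open>M ^ 2 / 2\<close> possible edges, a fraction above \<open>2 / a ^ 2\<close>, and each
  greedy edge disposes of at least this fraction of the unjoined pairs. After
  \<open>(ln a + 1) * a ^ 2 * n\<close> edges, rounded up, less than one pair remains; the rounding
  gives the final \<open>+ 1\<close>.\<close>

lemma sparse_joined_graph:
  fixes a n :: nat
  assumes a: "2 \<le> a" and n: "1 \<le> n"
  shows "\<exists>E. is_graph E \<and> real (card E) \<le> (ln a + 1) * a ^ 2 * n + 1 \<and>
           (\<forall>X Y. X \<subseteq> {..<a * n} \<longrightarrow> Y \<subseteq> {..<a * n} \<longrightarrow> X \<inter> Y = {} \<longrightarrow> card X = n \<longrightarrow> card Y = n \<longrightarrow>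
              (\<exists>x\<in>X. \<exists>y\<in>Y. {x, y} \<in> E))"
proof -
  define M where "M = a * n"
  define K where "K = {e. e \<subseteq> {..<M} \<and> card e = 2}"
  define P where "P = {(X, Y). X \<subseteq> {..<M} \<and> Y \<subseteq> {..<M} \<and> X \<inter> Y = {} \<and> card X = n \<and> card Y = n}"
  define H where "H = (\<lambda>(X, Y). (\<lambda>(x, y). {x, y}) ` (X \<times> Y :: (nat \<times> nat) set))"
  define r where "r = (ln a + 1) * a ^ 2 * n"
  define m where "m = nat \<lceil>r\<rceil>"
  have M2: "2 * n \<le> M" using a by (simp add: M_def)
  have finK: "finite K" by (simp add: K_def)
  have cardK: "card K = M * (M - 1) div 2"
    unfolding K_def by (simp add: n_subsets choose_two)
  have "even (M * (M - 1))" by (cases M) auto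
  then have cardK2: "2 * card K = M * (M - 1)" by (simp add: cardK)
  have KM: "2 * real (card K) < real M ^ 2"
  proof -
    have "2 * card K < M * M" unfolding cardK2 using M2 n by simp
    then have "real (2 * card K) < real (M * M)" by (simp only: of_nat_less_iff)
    then show ?thesis by (simp add: power2_eq_square)
  qed
  have nK: "n ^ 2 \<le> card K"
  proof -
    have "(2 * n) * n \<le> M * (M - 1)" using M2 n by (intro mult_le_mono) auto
    then show ?thesis unfolding cardK2[symmetric] by (simp add: power2_eq_square)
  qed
  then have posK: "0 < card K" using n by (metis less_le_trans zero_less_power less_le_trans zero_less_one)
  let ?S = "{X. X \<subseteq> {..<M} \<and> card X = n}"
  have finS: "finite ?S" by simp
  have PS: "P \<subseteq> ?S \<times> ?S" by (auto simp: P_def)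
  have finP: "finite P" using PS finS by (meson finite_SigmaI finite_subset)
  have "card P \<le> card (?S \<times> ?S)" using PS finS by (intro card_mono) auto
  also have "\<dots> = (M choose n) ^ 2" by (simp add: n_subsets card_cartesian_product power2_eq_square)
  finally have cardP: "card P \<le> (M choose n) ^ 2" .
  have H: "H p \<subseteq> K \<and> n ^ 2 \<le> card (H p)" if p: "p \<in> P" for p
  proof -
    obtain X Y where XY: "p = (X, Y)" "X \<subseteq> {..<M}" "Y \<subseteq> {..<M}" "X \<inter> Y = {}" "card X = n" "card Y = n"
      using p by (auto simp: P_def)
    have "inj_on (\<lambda>(x, y). {x, y}) (X \<times> Y)"
      using XY(4) by (auto simp: inj_on_def doubleton_eq_iff)
    then have "card (H p) = n ^ 2"
      using XY by (simp add: H_def card_image card_cartesian_product power2_eq_square)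
    moreover have "H p \<subseteq> K"
    proof
      fix e assume "e \<in> H p"
      then obtain x y where "x \<in> X" "y \<in> Y" "e = {x, y}" using XY(1) by (auto simp: H_def)
      then show "e \<in> K" using XY(2-4) by (auto simp: K_def card_insert_if)
    qed
    ultimately show ?thesis by simp
  qed
  have "\<exists>E\<subseteq>K. card E \<le> m \<and> real (card {p \<in> P. E \<inter> H p = {}}) \<le> card P * (1 - real (n ^ 2) / card K) ^ m"
    by (rule greedy_hitting_set[OF finP finK nK posK]) (rule H)
  then obtain E where E: "E \<subseteq> K" "card E \<le> m"
    and unhit: "real (card {p \<in> P. E \<inter> H p = {}}) \<le> card P * (1 - real (n ^ 2) / card K) ^ m"
    by blast
  have r0: "0 \<le> r" using a by (simp add: r_def)
  have mr: "r \<le> real m" "real m \<le> r + 1"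
    using r0 unfolding m_def by linarith+
  have "real (card P) * (1 - real (n ^ 2) / card K) ^ m < 1"
  proof -
    define x where "x = real (n ^ 2) / card K"
    have x1: "x \<le> 1" "0 \<le> x" using nK posK by (simp_all add: x_def flip: of_nat_power)
    have "2 / a ^ 2 < x"
    proof -
      have "2 * real (card K) < real a ^ 2 * real n ^ 2" using KM by (simp add: M_def power_mult_distrib)
      then show ?thesis using posK a by (simp add: x_def field_simps)
    qed
    moreover have "0 < r" using a n by (simp add: r_def add_pos_nonneg)
    ultimately have "2 / a ^ 2 * r < x * r" by (rule mult_strict_right_mono)
    also have "\<dots> \<le> x * m" using mr(1) x1 by (intro mult_left_mono) auto
    finally have "2 / a ^ 2 * r < x * m" .
    moreover have "2 / a ^ 2 * r = 2 * n * (ln a + 1)" using a by (simp add: r_def field_simps)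
    ultimately have xm: "2 * n * (ln a + 1) < x * m" by simp
    have "(1 - x) ^ m \<le> exp (- x) ^ m" using x1 exp_ge_add_one_self[of "- x"] by (intro power_mono) auto
    also have "\<dots> = exp (- (x * m))" by (simp add: exp_of_nat_mult[symmetric] mult.commute)
    also have "\<dots> < exp (- (2 * n * (ln a + 1)))" using xm by simp
    finally have pw: "(1 - x) ^ m < exp (- (2 * n * (ln a + 1)))" .
    have "real (M choose n) * fact n \<le> real M ^ n"
      using binomial_fact_pow[of M n] by (metis of_nat_fact of_nat_le_iff of_nat_mult of_nat_power)
    then have "real (M choose n) \<le> real M ^ n / fact n" by (simp add: field_simps)
    also have "\<dots> = real a ^ n * (real n ^ n / fact n)" by (simp add: M_def power_mult_distrib)
    also have "\<dots> \<le> real a ^ n * exp n" by (intro mult_left_mono power_div_fact_le_exp) auto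
    also have "real a ^ n = exp (n * ln a)" using a by (simp add: exp_of_nat_mult)
    finally have "real (M choose n) \<le> exp (n * (ln a + 1))" by (simp add: exp_add[symmetric] algebra_simps)
    then have "real (M choose n) ^ 2 \<le> exp (n * (ln a + 1)) ^ 2" by (intro power_mono) auto
    also have "\<dots> = exp (2 * n * (ln a + 1))" by (simp add: exp_of_nat_mult[symmetric] power2_eq_square exp_add[symmetric] algebra_simps)
    finally have "real (M choose n) ^ 2 \<le> exp (2 * n * (ln a + 1))" .
    moreover have "real (card P) \<le> real (M choose n) ^ 2" using cardP by (simp flip: of_nat_power)
    ultimately have cP: "real (card P) \<le> exp (2 * n * (ln a + 1))" by linarith
    have "real (card P) * (1 - x) ^ m \<le> exp (2 * n * (ln a + 1)) * (1 - x) ^ m"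
      using cP x1 by (intro mult_right_mono) auto
    also have "\<dots> < exp (2 * n * (ln a + 1)) * exp (- (2 * n * (ln a + 1)))"
      using pw by (intro mult_strict_left_mono) auto
    also have "\<dots> = 1" by (simp add: exp_minus_inverse)
    finally show ?thesis by (simp add: x_def)
  qed
  then have "card {p \<in> P. E \<inter> H p = {}} = 0" using unhit by linarith
  then have "{p \<in> P. E \<inter> H p = {}} = {}" using finP by simp
  then have hit: "E \<inter> H p \<noteq> {}" if "p \<in> P" for p using that by blast
  have "\<exists>x\<in>X. \<exists>y\<in>Y. {x, y} \<in> E"
    if "X \<subseteq> {..<a * n}" "Y \<subseteq> {..<a * n}" "X \<inter> Y = {}" "card X = n" "card Y = n" for X Y
    using hit[of "(X, Y)"] that by (auto simp: P_def M_def H_def)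
  moreover have "finite E" using E(1) finK by (rule finite_subset)
  then have "is_graph E" using E(1) by (auto simp: is_graph_def K_def)
  moreover have "real (card E) \<le> r + 1" using E(2) mr(2) by linarith
  ultimately show ?thesis unfolding r_def by blast
qed

section \<open>Back to the given notions, and comparison of the constants\<close>

lemma has_cycle_if_cyclic:
  assumes "cyclic (\<lambda>x y. {x, y} \<in> F) l" "3 \<le> l"
  shows "has_cycle l F"
proof -
  obtain xs where xs: "length xs = l" "distinct xs" "closed_walk (\<lambda>x y. {x, y} \<in> F) xs"
    using assms(1) by (auto simp: cyclic_def)
  have "{xs ! i, xs ! (Suc i mod l)} \<in> F" if "i < l" for i
  proof (cases "Suc i < l")
    case True
    then show ?thesis using xs by (auto simp: closed_walk_def successively_conv_nth)
  next
    case False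
    then have "Suc i = l" using that by simp
    then have i: "i = l - 1" "Suc i mod l = 0" by auto
    have "{last xs, hd xs} \<in> F" "xs \<noteq> []" using xs(3) by (auto simp: closed_walk_def)
    then show ?thesis using i xs(1) by (simp add: last_conv_nth hd_conv_nth)
  qed
  moreover have "inj_on (\<lambda>i. xs ! i) {0..<l}" using xs by (auto simp: inj_on_def nth_eq_iff_index_eq)
  ultimately show ?thesis using assms(2) unfolding has_cycle_def by blast
qed

text \<open>For \<open>q = 0\<close> the exponent \<open>2 ^ q - 2\<close> is -1, hence
  \<open>powr\<close>. The extra 1 on the left will absorb the rounding of the number of
  edges.\<close>

lemma vertex_factor_le:
  assumes "1 \<le> p + q"
  shows "real (vertex_factor p q) + 1 \<le> 82 * 35 powr (2 ^ q - 2) * 81 ^ p"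
proof (cases q)
  case 0
  then have p: "1 \<le> p" using assms by simp
  have "(25::real) ^ p \<le> 81 ^ p" by (rule power_mono) auto
  moreover have "(81::real) ^ 1 \<le> 81 ^ p" using p by (rule power_increasing) auto
  ultimately show ?thesis using 0 by (simp add: vertex_factor_def powr_minus)
next
  case (Suc s)
  \<comment> \<open>Passing from \<open>s\<close> to \<open>Suc s\<close> in \<open>main\<close>,
    with \<open>m = 2 ^ Suc s\<close>, multiplies the loss by \<open>52 * 25 ^ (m - 1)\<close> and
    the bound by \<open>35 ^ m\<close>. For \<open>m = 2\<close> the comparison fails (1300 against
    1225), so \<open>s = 0\<close> and \<open>s = 1\<close> are both settled by computation.\<close>
  have step: "52 * 25 ^ (m - 1) \<le> (35::nat) ^ m" if "4 \<le> m" for m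
    using that
  proof (induction m rule: dec_induct)
    case (step m)
    obtain j where "m = Suc j" using step.hyps by (cases m) auto
    then show ?case using step.IH by simp
  qed simp
  have main: "52 ^ Suc s * 25 ^ odd_cost s + 1 \<le> (82::nat) * 35 ^ (2 ^ Suc s - 2)" for s
  proof (induction s)
    case (Suc s)
    show ?case
    proof (cases s)
      case (Suc r)
      let ?m = "2 ^ Suc s :: nat"
      have m4: "4 \<le> ?m" by (simp add: Suc)
      have "52 ^ Suc (Suc s) * 25 ^ odd_cost (Suc s) + (1::nat)
          = (52 ^ Suc s * 25 ^ odd_cost s) * (52 * 25 ^ (?m - 1)) + 1"
        by (simp only: odd_cost.simps power_add power_Suc mult_ac)
      also have "\<dots> \<le> (52 ^ Suc s * 25 ^ odd_cost s + 1) * (52 * 25 ^ (?m - 1))"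
        by (simp add: algebra_simps)
      also have "\<dots> \<le> (82 * 35 ^ (?m - 2)) * 35 ^ ?m"
        by (rule mult_le_mono[OF Suc.IH step[OF m4]])
      also have "\<dots> = 82 * 35 ^ (?m - 2 + ?m)" by (simp only: power_add mult.assoc)
      also have "?m - 2 + ?m = 2 ^ Suc (Suc s) - 2" using m4 by simp
      finally show ?thesis .
    qed simp
  qed simp
  have "vertex_factor p q + 1 \<le> (52 ^ Suc s * 25 ^ odd_cost s + 1) * 25 ^ p"
    by (simp add: vertex_factor_def Suc power_add algebra_simps)
  also have "\<dots> \<le> (82 * 35 ^ (2 ^ Suc s - 2)) * 81 ^ p"
    by (rule mult_le_mono[OF main]) (rule power_mono, auto)
  finally have "real (vertex_factor p q + 1) \<le> real ((82 * 35 ^ (2 ^ Suc s - 2)) * 81 ^ p)"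
    by (simp only: of_nat_le_iff)
  moreover have "real (2 ^ Suc s - 2) = 2 ^ q - 2"
    using Suc by (subst of_nat_diff) (auto simp: self_le_power)
  then have "(35::real) powr (2 ^ q - 2) = 35 ^ (2 ^ Suc s - 2)"
    by (metis powr_realpow zero_less_numeral)
  ultimately show ?thesis by simp
qed

theorem theorem1p1:
  fixes t :: nat
  assumes "t \<ge> 1"
  shows "\<exists>N::nat. \<forall>ns :: nat list.
     length ns = t \<longrightarrow> (\<forall>i<t. ns ! i \<ge> N) \<longrightarrow>
     (let te = card {i. i < t \<and> even (ns ! i)};
          to = card {i. i < t \<and> odd (ns ! i)};
          c = 82 * (35::real) powr (2 ^ to - 2) * 81 ^ te;
          n = Max (set ns)
      in (\<forall>i<t. real (ns ! i) \<ge> 2 * real_of_int \<lceil>log 2 (real n * c)\<rceil> + 2) \<longrightarrow>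
         real (size_ramsey_cycles ns) \<le> (ln c + 1) * c ^ 2 * real n)"
proof (intro exI allI impI)
  fix ns :: "nat list"
  \<comment> \<open>The power of 2 is the witness for \<open>N\<close>. It forces the rounded
    logarithm \<open>y\<close> to be at least \<open>2 * 2 ^ t + 14\<close>, enough to pay for
    \<open>2 ^ t\<close> and the constants in the length condition.\<close>
  assume lns: "length ns = t" and big: "\<forall>i<t. (2::nat) ^ (2 * 2 ^ t + 14) \<le> ns ! i"
  define te where "te = card {i. i < t \<and> even (ns ! i)}"
  define to where "to = card {i. i < t \<and> odd (ns ! i)}"
  define c where "c = 82 * (35::real) powr (2 ^ to - 2) * 81 ^ te"
  define n where "n = Max (set ns)"
  have "real (size_ramsey_cycles ns) \<le> (ln c + 1) * c ^ 2 * real n"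
    if lo: "\<forall>i<t. real (ns ! i) \<ge> 2 * real_of_int \<lceil>log 2 (real n * c)\<rceil> + 2"
  proof -
    define a where "a = vertex_factor te to"
    have "te + to = card ({i. i < t \<and> even (ns ! i)} \<union> {i. i < t \<and> odd (ns ! i)})"
      unfolding te_def to_def by (rule card_Un_disjoint[symmetric]) auto
    also have "{i. i < t \<and> even (ns ! i)} \<union> {i. i < t \<and> odd (ns ! i)} = {..<t}" by auto
    finally have "1 \<le> te + to" using assms by simp
    then have ac: "real a + 1 \<le> c" unfolding a_def c_def by (rule vertex_factor_le)
    have a2: "2 \<le> a"
    proof (cases to)
      case (Suc s)
      have "(52::nat) * 1 \<le> 52 ^ Suc s * 25 ^ (odd_cost s + te)" by (rule mult_le_mono) auto
      then show ?thesis by (simp add: a_def vertex_factor_def Suc)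
    qed (simp add: a_def vertex_factor_def)
    have nsn: "ns ! i \<le> n" if "i < t" for i using that lns by (simp add: n_def)
    have nbig: "2 ^ (2 * 2 ^ t + 14) \<le> n" using big nsn[of 0] assms by fastforce
    then have n1: "1 \<le> n" by (meson le_trans one_le_numeral one_le_power)
    define y where "y = nat \<lceil>log 2 (real n * c)\<rceil>"
    have nc: "real n \<le> real n * c" using ac n1 by simp
    have y1: "2 * 2 ^ t + 14 \<le> y"
    proof -
      have "real (2 ^ (2 * 2 ^ t + 14)) \<le> real n" using nbig by (simp only: of_nat_le_iff)
      then have "(2::real) ^ (2 * 2 ^ t + 14) \<le> real n * c"
        using nc by (simp only: of_nat_power of_nat_numeral)
      then have "real (2 * 2 ^ t + 14) \<le> log 2 (real n * c)" by (rule le_log_of_power) simp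
      then show ?thesis unfolding y_def by linarith
    qed
    have y2: "real n * c \<le> 2 ^ y"
    proof -
      have "log 2 (real n * c) \<le> real y" unfolding y_def by linarith
      then have "real n * c \<le> 2 powr (real y)" using n1 nc by (subst (asm) log_le_iff) auto
      then show ?thesis by (simp add: powr_realpow)
    qed
    have lo': "2 * y + 2 \<le> ns ! i" if "i < t" for i
    proof -
      have "real_of_int \<lceil>log 2 (real n * c)\<rceil> = real y" using y1 unfolding y_def by linarith
      then show ?thesis using lo that by auto
    qed
    \<comment> \<open>About two thirds of \<open>y\<close>. With \<open>j = (y + 3) div 3\<close>
      one has \<open>y + 1 \<le> 3 * j\<close>, so
      \<open>2 ^ Suc y \<le> 8 ^ j \<le> 9 ^ j = 3 ^ h\<close>, while \<open>2 * h\<close> is only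
      about \<open>4 * y / 3\<close>, well below the \<open>2 * y + 2\<close> granted by the
      hypothesis.\<close>
    define h where "h = 2 * ((y + 3) div 3)"
    have hy: "2 * (a * n) \<le> 3 ^ h"
    proof -
      define j where "j = (y + 3) div 3"
      have "real (a * n) \<le> real n * c" using ac mult_right_mono[of a c n] by (simp add: mult.commute)
      then have "real (a * n) \<le> real (2 ^ y)" using y2 by simp
      then have "a * n \<le> 2 ^ y" by (simp only: of_nat_le_iff)
      then have "2 * (a * n) \<le> 2 ^ Suc y" by simp
      also have "(2::nat) ^ Suc y \<le> 2 ^ (3 * j)" unfolding j_def by (rule power_increasing) auto
      also have "\<dots> = 8 ^ j" by (simp add: power_mult)
      also have "(8::nat) ^ j \<le> 9 ^ j" by (rule power_mono) auto
      also have "\<dots> = 3 ^ h" by (simp add: h_def j_def[symmetric] power_mult)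
      finally show ?thesis .
    qed
    have hn: "2 * h + 6 + 2 ^ t \<le> ns ! i \<and> ns ! i \<le> n" if "i < t" for i
    proof -
      have "3 * h \<le> 2 * (y + 3)" by (simp add: h_def)
      then have "6 * h + 18 + 3 * 2 ^ t \<le> 4 * y + 12 + 18 + 3 * 2 ^ t" by simp
      also have "\<dots> \<le> 6 * y + 6" using y1 by simp
      finally show ?thesis using lo'[OF that] nsn[OF that] by simp
    qed
    obtain E where E: "is_graph E" "real (card E) \<le> (ln a + 1) * a ^ 2 * n + 1"
      and EXY: "\<And>X Y. X \<subseteq> {..<a * n} \<Longrightarrow> Y \<subseteq> {..<a * n} \<Longrightarrow> X \<inter> Y = {} \<Longrightarrow> card X = n \<Longrightarrow> card Y = n \<Longrightarrow>
              \<exists>x\<in>X. \<exists>y\<in>Y. {x, y} \<in> E"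
      using sparse_joined_graph[OF a2 n1] by blast
    have "arrows_cycles E ns"
      unfolding arrows_cycles_def
    proof (intro allI impI)
      fix col :: "nat set \<Rightarrow> nat" assume col: "\<forall>e\<in>E. col e < length ns"
      have "\<exists>i<t. cyclic (\<lambda>x y. {x, y} \<in> {e \<in> E. col e = i}) (ns ! i)"
      proof (rule monochromatic_cycle[where V = "{..<a * n}" and h = h and n = n])
        show "symp (\<lambda>x y. {x, y} \<in> {e \<in> E. col e = i})" for i by (auto simp: symp_def insert_commute)
        show "vertex_factor (card {i. i < t \<and> even (ns ! i)}) (card {i. i < t \<and> odd (ns ! i)}) * n
            \<le> card {..<a * n}" by (simp add: a_def te_def to_def)
        show "\<exists>x\<in>X. \<exists>y\<in>Y. \<exists>i<t. {x, y} \<in> {e \<in> E. col e = i}"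
          if "X \<subseteq> {..<a * n}" "Y \<subseteq> {..<a * n}" "X \<inter> Y = {}" "card X = n" "card Y = n" for X Y
          using EXY[OF that] col lns by blast
      qed (use hy hn in auto)
      then obtain i where i: "i < t" "cyclic (\<lambda>x y. {x, y} \<in> {e \<in> E. col e = i}) (ns ! i)" by blast
      then have "has_cycle (ns ! i) {e \<in> E. col e = i}"
        using hn[of i] by (intro has_cycle_if_cyclic) auto
      then show "\<exists>i<length ns. has_cycle (ns ! i) {e \<in> E. col e = i}" using i lns by auto
    qed
    then have "size_ramsey_cycles ns \<le> card E"
      unfolding size_ramsey_cycles_def using E(1) by (intro Least_le) blast
    then have "real (size_ramsey_cycles ns) \<le> (ln a + 1) * a ^ 2 * n + 1" using E(2) by linarith
    \<comment> \<open>The rounding term 1 is at most \<open>(ln a + 1) * n\<close>; next,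
      \<open>a ^ 2 + 1 \<le> (a + 1) ^ 2 \<le> c ^ 2\<close>.\<close>
    also have "\<dots> \<le> (ln a + 1) * (real a ^ 2 + 1) * n"
    proof -
      have "1 * 1 \<le> (ln a + 1) * real n" using a2 n1 by (intro mult_mono) auto
      then show ?thesis by (simp add: algebra_simps)
    qed
    also have "\<dots> \<le> (ln c + 1) * c ^ 2 * n"
    proof -
      have "ln a \<le> ln c" using ac a2 by simp
      moreover have "real a ^ 2 + 1 \<le> (real a + 1) ^ 2" by (simp add: power2_eq_square algebra_simps)
      moreover have "(real a + 1) ^ 2 \<le> c ^ 2" using ac by (intro power_mono) auto
      moreover have "0 \<le> ln a" using a2 by simp
      ultimately show ?thesis by (intro mult_right_mono mult_mono) auto
    qed
    finally show ?thesis .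
  qed
  then show "let te = card {i. i < t \<and> even (ns ! i)};
          to = card {i. i < t \<and> odd (ns ! i)};
          c = 82 * (35::real) powr (2 ^ to - 2) * 81 ^ te;
          n = Max (set ns)
      in (\<forall>i<t. real (ns ! i) \<ge> 2 * real_of_int \<lceil>log 2 (real n * c)\<rceil> + 2) \<longrightarrow>
         real (size_ramsey_cycles ns) \<le> (ln c + 1) * c ^ 2 * real n"
    unfolding Let_def te_def to_def c_def n_def by blast
qed

end
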